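(* Let $G$ be a biconnected graph and let $s=s_1s_2\dots s_k$ be a sequence of splits which, carried out successively starting from $G$ (each $s_i$ splits one of the graphs currently present), produces the triconnected components of $G$. Colour the virtual edges arising along the way as follows, starting from $G$ (which has no coloured edges); for $i=1,\dots,k$: (1) if $s_i$ is a non-supporting split, the two new virtual edges created by $s_i$ are coloured red; (2) if $s_i$ is a 2.5-split at some vertex-edge-separator $(c,e)$ of the graph being split such that $e$ is a green virtual edge or a non-virtual edge, let $e^{\star},e^{\star\star}$ be the two new virtual edges created by $s_i$; then every virtual edge (in any of the current graphs) whose label occurs as the label of a virtual edge on the ear of $e^{\star}$ or on the ear of $e^{\star\star}$ (ears taken in the graphs containing them) is coloured green; (3) if $s_i$ is a 2.5-split only at vertex-edge-separators $(c,e)$ with $e$ red, the two new virtual edges created by $s_i$ are coloured red. Then the resulting red/green colouring of the virtual edges of the triconnected components of $G$ does not depend on the choice of the sequence $s$.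
   Context: All graphs are finite, may have parallel edges, and have no loops. A graph of order 2 with $k\ge 2$ edges is a $k$-edge (multiedge). Each graph $H$ carries a possibly empty set $E_V(H)\subseteq E(H)$ of virtual edges with an injective labelling $\ell_H:E_V(H)\to\mathbb{N}$; other edges are non-virtual; the original graph $G$ has no virtual edges. A graph is biconnected if it is connected and for all pairwise distinct vertices $u,v,w$ there is a $u$-$v$ path avoiding $w$. Splits: for a biconnected $H$ and $u,v\in V(H)$, partition $E(H)$ into separation classes, two edges being in the same class iff they lie on a common (possibly closed) path having neither $u$ nor $v$ as an internal vertex. $\{u,v\}$ is a separation pair if some union $E'$ of some but not all classes has $\min\{|E'|,|E(H)\setminus E'|\}\ge 2$; a split then replaces $H$ by $H[E']+e_1$ and $H[E(H)\setminus E']+e_2$, where $e_1,e_2$ are new edges joining $u,v$, both virtual with the same new label not used before; other virtual edges keep their labels. $e_1,e_2$ correspond to each other. A merge is the inverse operation. A biconnected graph without separation pair is triconnected. Splitting repeatedly until no split is possible gives split components (triangles, 3-edges, other triconnected graphs); merging the triangles as much as possible into cycles and the 3-edges as much as possible into multiedges gives the triconnected components of $G$ (unique up to renaming/relabelling virtual edges, by Hopcroft–Tarjan). Vertex-edge-separators and 2.5-splits: for a biconnected graph $H$ which is not a triangle, $(c,uv)\in V(H)\times E(H)$ is a vertex-edge-separator if $H-uv-c$ is disconnected; then $H-uv-c$ has exactly two components $C_u\ni u$, $C_v\ni v$. For $a\in\{u,v\}$ with other endpoint $b$, let $H_a=H[V(C_a)\cup\{c\}]$, $H_b=H[V(C_b)\cup\{c\}]$.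 If $|E(H_a)|\ge2$, then $\{a,c\}$ is a separation pair supporting $(c,uv)$, and the split replacing $H$ by $H_a+ac$ and $H_b+ba+ac$ (the two new edges $ac$ being corresponding virtual edges, $ba$ being the edge $uv$) is the 2.5-split at $(c,uv)$ with support $\{a,c\}$. A split that is not of this form for any vertex-edge-separator is non-supporting. Ears: for $e\in E(H)$, the ear of $e$ in $H$ is the maximal (possibly closed) path in $H$ containing $e$ all of whose internal vertices have degree 2 in $H$. *)

theory Defs
  imports Main
begin

text \<open>A graph is given by a vertex set V, an edge set E (edges are abstract objects
  of some type 'x) and an endpoint map ep; ep f is the 2-element set of endpoints of f
  (no loops, parallel edges allowed).  Only the values of ep on E matter.\<close>

definition wf_graph :: "('x \<Rightarrow> 'v set) \<Rightarrow> 'v set \<Rightarrow> 'x set \<Rightarrow> bool" where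
  "wf_graph ep V E \<longleftrightarrow> finite V \<and> finite E \<and> (\<forall>f\<in>E. ep f \<subseteq> V \<and> card (ep f) = 2)"

definition is_path :: "('x \<Rightarrow> 'v set) \<Rightarrow> 'v set \<Rightarrow> 'x set \<Rightarrow> 'v list \<Rightarrow> 'x list \<Rightarrow> bool" where
  "is_path ep V E vs es \<longleftrightarrow>
     length vs = Suc (length es) \<and> set vs \<subseteq> V \<and> set es \<subseteq> E \<and> distinct es \<and>
     (\<forall>i<length es. ep (es ! i) = {vs ! i, vs ! Suc i}) \<and>
     (distinct vs \<or> (hd vs = last vs \<and> distinct (tl vs)))"

definition internal_vertices :: "'v list \<Rightarrow> 'x list \<Rightarrow> 'v set" where
  "internal_vertices vs es = {vs ! i | i. 0 < i \<and> i < length es}"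

definition connected_graph :: "('x \<Rightarrow> 'v set) \<Rightarrow> 'v set \<Rightarrow> 'x set \<Rightarrow> bool" where
  "connected_graph ep V E \<longleftrightarrow>
     (\<forall>x\<in>V. \<forall>y\<in>V. \<exists>vs es. is_path ep V E vs es \<and> hd vs = x \<and> last vs = y)"

definition reachable :: "('x \<Rightarrow> 'v set) \<Rightarrow> 'v set \<Rightarrow> 'x set \<Rightarrow> 'v \<Rightarrow> 'v \<Rightarrow> bool" where
  "reachable ep V E x y \<longleftrightarrow> (\<exists>vs es. is_path ep V E vs es \<and> hd vs = x \<and> last vs = y)"

definition biconnected :: "('x \<Rightarrow> 'v set) \<Rightarrow> 'v set \<Rightarrow> 'x set \<Rightarrow> bool" where
  "biconnected ep V E \<longleftrightarrow> connected_graph ep V E \<and>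
     (\<forall>u\<in>V. \<forall>v\<in>V. \<forall>w\<in>V. u \<noteq> v \<and> u \<noteq> w \<and> v \<noteq> w \<longrightarrow>
        (\<exists>vs es. is_path ep V E vs es \<and> hd vs = u \<and> last vs = v \<and> w \<notin> set vs))"

definition degree :: "('x \<Rightarrow> 'v set) \<Rightarrow> 'x set \<Rightarrow> 'v \<Rightarrow> nat" where
  "degree ep E x = card {f\<in>E. x \<in> ep f}"

definition triangle :: "('x \<Rightarrow> 'v set) \<Rightarrow> 'v set \<Rightarrow> 'x set \<Rightarrow> bool" where
  "triangle ep V E \<longleftrightarrow> wf_graph ep V E \<and> card V = 3 \<and> card E = 3 \<and> inj_on ep E"

definition polygon :: "('x \<Rightarrow> 'v set) \<Rightarrow> 'v set \<Rightarrow> 'x set \<Rightarrow> bool" where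
  "polygon ep V E \<longleftrightarrow> wf_graph ep V E \<and> 3 \<le> card V \<and> connected_graph ep V E \<and>
     (\<forall>x\<in>V. degree ep E x = 2)"

definition multiedge :: "('x \<Rightarrow> 'v set) \<Rightarrow> 'v set \<Rightarrow> 'x set \<Rightarrow> bool" where
  "multiedge ep V E \<longleftrightarrow> wf_graph ep V E \<and> card V = 2 \<and> 2 \<le> card E"

definition same_class :: "('x \<Rightarrow> 'v set) \<Rightarrow> 'v set \<Rightarrow> 'x set \<Rightarrow> 'v \<Rightarrow> 'v \<Rightarrow> 'x \<Rightarrow> 'x \<Rightarrow> bool" where
  "same_class ep V E u v e f \<longleftrightarrow>
     (\<exists>vs es. is_path ep V E vs es \<and> e \<in> set es \<and> f \<in> set es \<and>
              u \<notin> internal_vertices vs es \<and> v \<notin> internal_vertices vs es)"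

text \<open>E' is a union of some but not all separation classes w.r.t. {u,v}, with
  min(|E'|, |E - E'|) \<ge> 2 (the witness that {u,v} is a separation pair).\<close>

definition sep_union :: "('x \<Rightarrow> 'v set) \<Rightarrow> 'v set \<Rightarrow> 'x set \<Rightarrow> 'v \<Rightarrow> 'v \<Rightarrow> 'x set \<Rightarrow> bool" where
  "sep_union ep V E u v E' \<longleftrightarrow> u \<noteq> v \<and> u \<in> V \<and> v \<in> V \<and> E' \<subseteq> E \<and>
     (\<forall>e\<in>E'. \<forall>f\<in>E. same_class ep V E u v e f \<longrightarrow> f \<in> E') \<and>
     2 \<le> card E' \<and> 2 \<le> card (E - E')"

definition ear_candidate :: "('x \<Rightarrow> 'v set) \<Rightarrow> 'v set \<Rightarrow> 'x set \<Rightarrow> 'x \<Rightarrow> 'v list \<Rightarrow> 'x list \<Rightarrow> bool" where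
  "ear_candidate ep V E e vs es \<longleftrightarrow> is_path ep V E vs es \<and> e \<in> set es \<and>
     (\<forall>x\<in>internal_vertices vs es. degree ep E x = 2)"

definition is_ear :: "('x \<Rightarrow> 'v set) \<Rightarrow> 'v set \<Rightarrow> 'x set \<Rightarrow> 'x \<Rightarrow> 'v list \<Rightarrow> 'x list \<Rightarrow> bool" where
  "is_ear ep V E e vs es \<longleftrightarrow> ear_candidate ep V E e vs es \<and>
     (\<forall>vs' es'. ear_candidate ep V E e vs' es' \<and> set es \<subseteq> set es' \<longrightarrow> set es' = set es)"

definition ves :: "('x \<Rightarrow> 'v set) \<Rightarrow> 'v set \<Rightarrow> 'x set \<Rightarrow> 'v \<Rightarrow> 'x \<Rightarrow> bool" where
  "ves ep V E c e \<longleftrightarrow> biconnected ep V E \<and> \<not> triangle ep V E \<and> c \<in> V \<and> e \<in> E \<and>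
     \<not> connected_graph ep (V - {c}) {f \<in> E - {e}. c \<notin> ep f}"

definition comp_of :: "('x \<Rightarrow> 'v set) \<Rightarrow> 'v set \<Rightarrow> 'x set \<Rightarrow> 'v \<Rightarrow> 'x \<Rightarrow> 'v \<Rightarrow> 'v set" where
  "comp_of ep V E c e a = {x. reachable ep (V - {c}) {f \<in> E - {e}. c \<notin> ep f} a x}"

definition side_edges :: "('x \<Rightarrow> 'v set) \<Rightarrow> 'v set \<Rightarrow> 'x set \<Rightarrow> 'v \<Rightarrow> 'x \<Rightarrow> 'v \<Rightarrow> 'x set" where
  "side_edges ep V E c e a = {f\<in>E. ep f \<subseteq> comp_of ep V E c e a \<union> {c}}"

text \<open>The split of (V,E) at pair {x,y} into the edge sets E' and E - E' is the 2.5-split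
  at the vertex-edge-separator (c,e) with support {a,c} (a an endpoint of e).\<close>

definition is_25split :: "('x \<Rightarrow> 'v set) \<Rightarrow> 'v set \<Rightarrow> 'x set \<Rightarrow> 'v \<Rightarrow> 'x \<Rightarrow> 'v \<Rightarrow>
    'v \<Rightarrow> 'v \<Rightarrow> 'x set \<Rightarrow> bool" where
  "is_25split ep V E c e a x y E' \<longleftrightarrow> ves ep V E c e \<and> a \<in> ep e \<and>
     2 \<le> card (side_edges ep V E c e a) \<and> {x, y} = {a, c} \<and>
     (E' = side_edges ep V E c e a \<or> E' = E - side_edges ep V E c e a)"

text \<open>Edges: original edges of G, or virtual edges.  A virtual edge is Virt n b, its label
  is n; the two corresponding virtual edges created by a split are Virt n True and
  Virt n False.\<close>

datatype 'e edg = Orig 'e | Virt nat bool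

type_synonym ('v, 'e) gr = "'v set \<times> 'e edg set"
type_synonym ('v, 'e) state = "('v, 'e) gr set \<times> ('e edg \<Rightarrow> 'v set)"

definition labels :: "('v, 'e) gr set \<Rightarrow> nat set" where
  "labels S = {n. \<exists>H\<in>S. \<exists>b. Virt n b \<in> snd H}"

definition init_state :: "'v set \<Rightarrow> 'e set \<Rightarrow> ('e \<Rightarrow> 'v set) \<Rightarrow> ('v, 'e) state" where
  "init_state VG EG epG = ({(VG, Orig ` EG)}, (\<lambda>x. case x of Orig f \<Rightarrow> epG f | Virt _ _ \<Rightarrow> {}))"

definition split_ok :: "('v, 'e) state \<Rightarrow> ('v, 'e) gr \<Rightarrow> 'v \<Rightarrow> 'v \<Rightarrow> 'e edg set \<Rightarrow> nat \<Rightarrow> bool" where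
  "split_ok st H u v E' n \<longleftrightarrow> H \<in> fst st \<and> biconnected (snd st) (fst H) (snd H) \<and>
     sep_union (snd st) (fst H) (snd H) u v E' \<and> n \<notin> labels (fst st)"

definition split_ep :: "('v, 'e) state \<Rightarrow> 'v \<Rightarrow> 'v \<Rightarrow> nat \<Rightarrow> ('e edg \<Rightarrow> 'v set)" where
  "split_ep st u v n = (snd st)(Virt n True := {u, v}, Virt n False := {u, v})"

definition piece1 :: "('v, 'e) state \<Rightarrow> ('v, 'e) gr \<Rightarrow> 'v \<Rightarrow> 'v \<Rightarrow> 'e edg set \<Rightarrow> nat \<Rightarrow> ('v, 'e) gr" where
  "piece1 st H u v E' n = (\<Union> (snd st ` E') \<union> {u, v}, insert (Virt n True) E')"

definition piece2 :: "('v, 'e) state \<Rightarrow> ('v, 'e) gr \<Rightarrow> 'v \<Rightarrow> 'v \<Rightarrow> 'e edg set \<Rightarrow> nat \<Rightarrow> ('v, 'e) gr" where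
  "piece2 st H u v E' n = (\<Union> (snd st ` (snd H - E')) \<union> {u, v}, insert (Virt n False) (snd H - E'))"

definition split_res :: "('v, 'e) state \<Rightarrow> ('v, 'e) gr \<Rightarrow> 'v \<Rightarrow> 'v \<Rightarrow> 'e edg set \<Rightarrow> nat \<Rightarrow> ('v, 'e) state" where
  "split_res st H u v E' n =
     ((fst st - {H}) \<union> {piece1 st H u v E' n, piece2 st H u v E' n}, split_ep st u v n)"

definition split_rel :: "('v, 'e) state \<Rightarrow> ('v, 'e) state \<Rightarrow> bool" where
  "split_rel st st' \<longleftrightarrow> (\<exists>H u v E' n. split_ok st H u v E' n \<and> st' = split_res st H u v E' n)"

definition merge_rel :: "('v, 'e) state \<Rightarrow> ('v, 'e) state \<Rightarrow> bool" where
  "merge_rel st st' \<longleftrightarrow> (\<exists>H1 H2 n. H1 \<in> fst st \<and> H2 \<in> fst st \<and> H1 \<noteq> H2 \<and>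
      Virt n True \<in> snd H1 \<and> Virt n False \<in> snd H2 \<and>
      ((polygon (snd st) (fst H1) (snd H1) \<and> polygon (snd st) (fst H2) (snd H2)) \<or>
       (multiedge (snd st) (fst H1) (snd H1) \<and> multiedge (snd st) (fst H2) (snd H2))) \<and>
      st' = ((fst st - {H1, H2}) \<union>
               {(fst H1 \<union> fst H2, (snd H1 \<union> snd H2) - {Virt n True, Virt n False})}, snd st))"

definition is_tricomps :: "('v, 'e) state \<Rightarrow> ('v, 'e) state \<Rightarrow> bool" where
  "is_tricomps st0 T \<longleftrightarrow> (\<exists>SC. split_rel\<^sup>*\<^sup>* st0 SC \<and> \<not> (\<exists>st'. split_rel SC st') \<and>
     merge_rel\<^sup>*\<^sup>* SC T \<and> \<not> (\<exists>st'. merge_rel T st'))"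

fun relabel :: "(nat \<Rightarrow> nat) \<Rightarrow> (nat \<Rightarrow> bool \<Rightarrow> bool) \<Rightarrow> 'e edg \<Rightarrow> 'e edg" where
  "relabel \<sigma> \<beta> (Orig f) = Orig f"
| "relabel \<sigma> \<beta> (Virt n b) = Virt (\<sigma> n) (\<beta> n b)"

definition iso_state :: "('v, 'e) state \<Rightarrow> ('v, 'e) state \<Rightarrow> (nat \<Rightarrow> nat) \<Rightarrow> (nat \<Rightarrow> bool \<Rightarrow> bool) \<Rightarrow> bool" where
  "iso_state st1 st2 \<sigma> \<beta> \<longleftrightarrow> inj_on \<sigma> (labels (fst st1)) \<and> (\<forall>n. inj (\<beta> n)) \<and>
     fst st2 = (\<lambda>H. (fst H, relabel \<sigma> \<beta> ` snd H)) ` fst st1 \<and>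
     (\<forall>H\<in>fst st1. \<forall>f\<in>snd H. snd st2 (relabel \<sigma> \<beta> f) = snd st1 f)"

definition produces_tricomps :: "'v set \<Rightarrow> 'e set \<Rightarrow> ('e \<Rightarrow> 'v set) \<Rightarrow> ('v, 'e) state \<Rightarrow> bool" where
  "produces_tricomps VG EG epG F \<longleftrightarrow>
     (\<exists>T \<sigma> \<beta>. is_tricomps (init_state VG EG epG) T \<and> iso_state F T \<sigma> \<beta>)"

datatype colour = Red | Green

text \<open>Colours are attached to labels (both corresponding virtual edges always get the
  same colour); None = uncoloured.\<close>

type_synonym colouring = "nat \<Rightarrow> colour option"

definition ear_labels :: "('e edg \<Rightarrow> 'v set) \<Rightarrow> ('v, 'e) gr \<Rightarrow> 'e edg \<Rightarrow> nat set" where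
  "ear_labels ep H e = {m. \<exists>vs es b. is_ear ep (fst H) (snd H) e vs es \<and> Virt m b \<in> set es}"

definition green_or_orig :: "colouring \<Rightarrow> 'e edg \<Rightarrow> bool" where
  "green_or_orig col e \<longleftrightarrow> (case e of Orig _ \<Rightarrow> True | Virt m _ \<Rightarrow> col m = Some Green)"

definition is_red :: "colouring \<Rightarrow> 'e edg \<Rightarrow> bool" where
  "is_red col e \<longleftrightarrow> (case e of Orig _ \<Rightarrow> False | Virt m _ \<Rightarrow> col m = Some Red)"

definition recolour :: "('v, 'e) state \<Rightarrow> ('v, 'e) gr \<Rightarrow> 'v \<Rightarrow> 'v \<Rightarrow> 'e edg set \<Rightarrow> nat \<Rightarrow>
    colouring \<Rightarrow> colouring" where
  "recolour st H u v E' n col =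
    (let ep = snd st; V = fst H; E = snd H;
         is25 = (\<lambda>c e a. is_25split ep V E c e a u v E')
     in if \<not> (\<exists>c e a. is25 c e a) then col(n := Some Red)
        else if (\<exists>c e a. is25 c e a \<and> green_or_orig col e) then
          (\<lambda>m. if m \<in> ear_labels (split_ep st u v n) (piece1 st H u v E' n) (Virt n True)
                  \<or> m \<in> ear_labels (split_ep st u v n) (piece2 st H u v E' n) (Virt n False)
               then Some Green else col m)
        else if (\<forall>c e a. is25 c e a \<longrightarrow> is_red col e) then col(n := Some Red)
        else col)"

inductive run :: "('v, 'e) state \<Rightarrow> colouring \<Rightarrow>
    (('v, 'e) gr \<times> 'v \<times> 'v \<times> 'e edg set \<times> nat) list \<Rightarrow> ('v, 'e) state \<Rightarrow> colouring \<Rightarrow> bool" where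
  run_Nil: "run st col [] st col"
| run_Cons: "split_ok st H u v E' n \<Longrightarrow>
     run (split_res st H u v E' n) (recolour st H u v E' n col) ss st'' col'' \<Longrightarrow>
     run st col ((H, u, v, E', n) # ss) st'' col''"

end

theory Submission
  imports Defs
begin

text \<open>Call two edges of a graph ear-adjacent if they share a vertex of degree 2; the ears are the
  classes of the generated equivalence.  The invariant of the colouring process is that a virtual
  edge is green iff one of its two copies lies on an ear containing an original edge, and red
  otherwise; the colours of the final state can then be read off the triconnected components.

  A split at \<open>{u, v}\<close> is a 2.5-split at \<open>(c, e)\<close> iff in one of the two pieces \<open>e\<close> is ear-adjacent
  to the new virtual edge.  Degrees only drop under further splits, and a triconnected component
  with a vertex of degree 2 is a polygon.  Since no two polygons of the final state share a label,
  a split never separates two ear-adjacent edges, and at most one of its two new edges lies on a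
  nontrivial ear.  Hence a split only joins the ears next to that one edge, which is what the
  colouring rules track.

  That the cycles produced by merging are again polygons follows by counting: the sum of
  \<open>|V(H)| - 2\<close> over all graphs is invariant under splits and can only drop under merges, and it has
  the same value for the given sequence of splits and for the triconnected components.\<close>

section \<open>Paths and separation pairs\<close>

text \<open>Two obstacles shape the argument. The final graphs arise by splits alone, so whole
  cycles remain uncut, while triconnected components are defined by splitting completely and then
  merging; the two are linked only by an isomorphism. Moreover \<open>merge_rel\<close> unites
  vertex sets without asking that they meet in just two vertices, so it is not evident that merged
  cycles form a cycle. The term \<open>card V - 2\<close> is the quantity that is additive exactly
  when the overlap is two vertices. The second obstacle is that the separation of polygons is known
  for the final state alone. An end of degree at most 2 persists under splits, so if both copies of
  a label had such an end at some moment, both would lie in polygons at the end. This pulls the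
  restriction back to every intermediate state. It is also what makes a colour on labels meaningful:
  rule (2) inspects one copy of a virtual edge, and green could otherwise stem from the ear of the
  other copy.\<close>

definition step :: "('x \<Rightarrow> 'v set) \<Rightarrow> 'v set \<Rightarrow> 'x set \<Rightarrow> 'v \<Rightarrow> 'v \<Rightarrow> bool" where
  "step ep V E x y \<longleftrightarrow> x \<in> V \<and> y \<in> V \<and> (\<exists>f\<in>E. ep f = {x, y})"

lemma wf_edge_ends:
  assumes "wf_graph ep V E" "f \<in> E" "x \<in> ep f"
  obtains y where "ep f = {x, y}" "y \<noteq> x" "x \<in> V" "y \<in> V"
proof -
  have "card (ep f) = 2" "ep f \<subseteq> V" using assms by (auto simp: wf_graph_def)
  then obtain p q where "ep f = {p, q}" "p \<noteq> q" "p \<in> V" "q \<in> V" by (auto simp: card_2_iff)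
  with assms(3) that show thesis by (metis doubleton_eq_iff insert_iff singletonD)
qed

lemma path_imp_steps:
  assumes "is_path ep V E vs es"
  shows "(step ep V E)\<^sup>*\<^sup>* (hd vs) (last vs)"
proof -
  have len: "length vs = Suc (length es)" and sub: "set vs \<subseteq> V" "set es \<subseteq> E"
    and ends: "\<forall>i<length es. ep (es ! i) = {vs ! i, vs ! Suc i}"
    using assms by (auto simp: is_path_def)
  have "(step ep V E)\<^sup>*\<^sup>* (vs ! 0) (vs ! i)" if "i \<le> length es" for i
    using that
  proof (induction i)
    case (Suc i)
    have "step ep V E (vs ! i) (vs ! Suc i)"
      unfolding step_def using Suc.prems len sub ends
      by (metis Suc_le_eq less_SucI nth_mem subsetD Suc_less_eq)
    with Suc show ?case by (meson Suc_leD rtranclp.rtrancl_into_rtrancl)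
  qed simp
  from this[of "length es"] show ?thesis
    using len by (metis diff_Suc_1 hd_conv_nth last_conv_nth le_refl length_0_conv nat.simps(3))
qed

text \<open>The path is grown one step at a time and truncated whenever the new vertex already
  occurs on it, so vertices and edges stay distinct.\<close>

lemma steps_imp_path:
  assumes "(step ep V E)\<^sup>*\<^sup>* x y" "x \<in> V"
  shows "\<exists>vs es. is_path ep V E vs es \<and> distinct vs \<and> hd vs = x \<and> last vs = y"
  using assms
proof (induction rule: rtranclp_induct)
  case base
  then show ?case by (intro exI[of _ "[x]"] exI[of _ "[]"]) (auto simp: is_path_def)
next
  case (step y z)
  then obtain vs es where p: "is_path ep V E vs es" "distinct vs" "hd vs = x" "last vs = y"
    by auto
  have len: "length vs = Suc (length es)" using p by (auto simp: is_path_def)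
  then have ne: "vs \<noteq> []" by auto
  obtain f where f: "f \<in> E" "ep f = {y, z}" and z: "z \<in> V"
    using step(2) by (auto simp: step_def)
  show ?case
  proof (cases "z \<in> set vs")
    case True
    then obtain k where k: "k < length vs" "vs ! k = z" by (auto simp: in_set_conv_nth)
    have "is_path ep V E (take (Suc k) vs) (take k es)"
      using p k len set_take_subset[of "Suc k" vs] set_take_subset[of k es]
      unfolding is_path_def by auto
    moreover have "hd (take (Suc k) vs) = x" using p ne by simp
    moreover have "last (take (Suc k) vs) = z"
      using k by (simp add: take_Suc_conv_app_nth)
    moreover have "distinct (take (Suc k) vs)" using p(2) by simp
    ultimately show ?thesis by blast
  next
    case False
    have "f \<notin> set es"
    proof
      assume "f \<in> set es"
      then obtain i where i: "i < length es" "es ! i = f" by (auto simp: in_set_conv_nth)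
      then have "ep f = {vs ! i, vs ! Suc i}" using p by (auto simp: is_path_def)
      then have "z \<in> set vs" using f i len by (metis Suc_less_eq insert_iff less_SucI nth_mem singletonD)
      with False show False by simp
    qed
    then have "is_path ep V E (vs @ [z]) (es @ [f])"
      using p f z False len ne unfolding is_path_def
      by (auto simp: nth_append last_conv_nth less_Suc_eq)
    then show ?thesis using p ne False
      by (intro exI[of _ "vs @ [z]"] exI[of _ "es @ [f]"]) auto
  qed
qed

lemma reachable_iff_steps:
  "reachable ep V E x y \<longleftrightarrow> x \<in> V \<and> (step ep V E)\<^sup>*\<^sup>* x y"
proof
  assume "reachable ep V E x y"
  then obtain vs es where p: "is_path ep V E vs es" "hd vs = x" "last vs = y"
    by (auto simp: reachable_def)
  then have "vs \<noteq> []" "set vs \<subseteq> V" by (auto simp: is_path_def)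
  then have "x \<in> V" using p(2) hd_in_set by blast
  with path_imp_steps[OF p(1)] p show "x \<in> V \<and> (step ep V E)\<^sup>*\<^sup>* x y" by simp
next
  assume "x \<in> V \<and> (step ep V E)\<^sup>*\<^sup>* x y"
  then show "reachable ep V E x y" using steps_imp_path by (fastforce simp: reachable_def)
qed

lemma connected_graph_iff_steps:
  "connected_graph ep V E \<longleftrightarrow> (\<forall>x\<in>V. \<forall>y\<in>V. (step ep V E)\<^sup>*\<^sup>* x y)"
  using reachable_iff_steps[of ep V E] unfolding connected_graph_def reachable_def by blast

text \<open>The edge set need not shrink when \<open>w\<close> is deleted: a path or a
  \<open>step\<close> must have its vertices in \<open>V - {w}\<close>, which excludes the edges at
  \<open>w\<close>.\<close>

lemma biconnected_iff:
  "biconnected ep V E \<longleftrightarrow>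
     connected_graph ep V E \<and> (\<forall>w\<in>V. connected_graph ep (V - {w}) E)"
proof -
  have p: "is_path ep (V - {w}) E vs es \<longleftrightarrow> is_path ep V E vs es \<and> w \<notin> set vs" for vs es w
    by (auto simp: is_path_def)
  have r: "\<exists>vs es. is_path ep (V - {w}) E vs es \<and> hd vs = u \<and> last vs = u"
    if "u \<in> V - {w}" for u w
    using that by (intro exI[of _ "[u]"] exI[of _ "[]"]) (auto simp: is_path_def)
  have "connected_graph ep (V - {w}) E \<longleftrightarrow> (\<forall>u\<in>V. \<forall>v\<in>V. u \<noteq> v \<and> u \<noteq> w \<and> v \<noteq> w \<longrightarrow>
      (\<exists>vs es. is_path ep V E vs es \<and> hd vs = u \<and> last vs = v \<and> w \<notin> set vs))" (is "?L \<longleftrightarrow> ?R") for w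
  proof
    assume ?L
    then show ?R unfolding connected_graph_def p by blast
  next
    assume R: ?R
    show ?L unfolding connected_graph_def
    proof (intro ballI)
      fix x y assume xy: "x \<in> V - {w}" "y \<in> V - {w}"
      show "\<exists>vs es. is_path ep (V - {w}) E vs es \<and> hd vs = x \<and> last vs = y"
      proof (cases "x = y")
        case True
        then show ?thesis using r xy by blast
      next
        case False
        then show ?thesis using R xy unfolding p by blast
      qed
    qed
  qed
  then show ?thesis unfolding biconnected_def by blast
qed

text \<open>A split updates one global endpoint map at two fresh edges. This and the following
  congruences carry facts about the untouched edges over to the new map.\<close>

lemma step_cong:
  assumes "\<And>f. f \<in> E \<Longrightarrow> ep' f = ep f"
  shows "step ep' V E = step ep V E"
  using assms by (auto simp: step_def fun_eq_iff)

lemma connected_graph_cong: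
  assumes "\<And>f. f \<in> E \<Longrightarrow> ep' f = ep f"
  shows "connected_graph ep' V E = connected_graph ep V E"
  using step_cong[of E ep' ep, OF assms] by (simp add: connected_graph_iff_steps)

lemma biconnected_cong:
  assumes "\<And>f. f \<in> E \<Longrightarrow> ep' f = ep f"
  shows "biconnected ep' V E = biconnected ep V E"
  using connected_graph_cong[of E ep' ep, OF assms] by (simp add: biconnected_iff)

lemma degree_cong:
  assumes "\<And>f. f \<in> E \<Longrightarrow> ep' f = ep f"
  shows "degree ep' E a = degree ep E a"
  using assms unfolding degree_def by (metis (mono_tags, lifting))

text \<open>Being a union of separation classes is a local condition at the vertices other than \<open>u\<close>
  and \<open>v\<close>: consecutive edges of a path meet in an internal vertex.\<close>

lemma sep_union_iff:
  assumes wf: "wf_graph ep V E"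
  shows "sep_union ep V E u v F \<longleftrightarrow> u \<noteq> v \<and> u \<in> V \<and> v \<in> V \<and> F \<subseteq> E \<and>
     (\<forall>e\<in>F. \<forall>f\<in>E. \<forall>x. x \<in> ep e \<and> x \<in> ep f \<and> x \<noteq> u \<and> x \<noteq> v \<longrightarrow> f \<in> F) \<and>
     2 \<le> card F \<and> 2 \<le> card (E - F)"
proof -
  have "(\<forall>e\<in>F. \<forall>f\<in>E. same_class ep V E u v e f \<longrightarrow> f \<in> F) \<longleftrightarrow>
     (\<forall>e\<in>F. \<forall>f\<in>E. \<forall>x. x \<in> ep e \<and> x \<in> ep f \<and> x \<noteq> u \<and> x \<noteq> v \<longrightarrow> f \<in> F)" (is "?L \<longleftrightarrow> ?R")
    if FE: "F \<subseteq> E"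
  proof
    assume L: ?L
    show ?R
    proof (intro ballI allI impI)
      fix e f x
      assume e: "e \<in> F" and f: "f \<in> E" and x: "x \<in> ep e \<and> x \<in> ep f \<and> x \<noteq> u \<and> x \<noteq> v"
      show "f \<in> F"
      proof (cases "e = f")
        case False
        have eE: "e \<in> E" using e FE by auto
        obtain p where p: "ep e = {x, p}" "p \<noteq> x" "p \<in> V" "x \<in> V"
          using wf_edge_ends[OF wf eE] x by metis
        obtain q where q: "ep f = {x, q}" "q \<noteq> x" "q \<in> V"
          using wf_edge_ends[OF wf f] x by metis
        have "is_path ep V E [p, x, q] [e, f]"
          using p q eE f False by (auto simp: is_path_def less_Suc_eq)
        moreover have "internal_vertices [p, x, q] [e, f] \<subseteq> {x}"
          by (auto simp: internal_vertices_def less_Suc_eq)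
        ultimately have "same_class ep V E u v e f" using x unfolding same_class_def
          by (intro exI[of _ "[p, x, q]"] exI[of _ "[e, f]"]) auto
        with L e f show ?thesis by blast
      qed (use e in simp)
    qed
  next
    assume R: ?R
    show ?L
    proof (intro ballI impI)
      fix e f assume e: "e \<in> F" and f: "f \<in> E" and "same_class ep V E u v e f"
      then obtain vs es where p: "is_path ep V E vs es" "e \<in> set es" "f \<in> set es"
        and iv: "u \<notin> internal_vertices vs es" "v \<notin> internal_vertices vs es"
        by (auto simp: same_class_def)
      have ends: "\<forall>i<length es. ep (es ! i) = {vs ! i, vs ! Suc i}" and esE: "set es \<subseteq> E"
        using p by (auto simp: is_path_def)
      have adj: "es ! i \<in> F \<longleftrightarrow> es ! Suc i \<in> F" if i: "Suc i < length es" for i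
      proof -
        have "vs ! Suc i \<in> internal_vertices vs es" using i by (auto simp: internal_vertices_def)
        then have "vs ! Suc i \<noteq> u" "vs ! Suc i \<noteq> v" using iv by auto
        moreover have "vs ! Suc i \<in> ep (es ! i)" "vs ! Suc i \<in> ep (es ! Suc i)"
          using ends i by auto
        moreover have "es ! i \<in> E" "es ! Suc i \<in> E" using esE i by auto
        ultimately show ?thesis using R by blast
      qed
      have all: "es ! i \<in> F \<longleftrightarrow> es ! 0 \<in> F" if "i < length es" for i
        using that by (induction i) (use adj in auto)
      from p obtain i j where "i < length es" "es ! i = e" "j < length es" "es ! j = f"
        by (auto simp: in_set_conv_nth)
      with all e show "f \<in> F" by blast
    qed
  qed
  then show ?thesis unfolding sep_union_def by blast
qed

section \<open>Separations: walks, vertices and degrees on the two sides\<close>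

locale separation =
  fixes ep :: "'x \<Rightarrow> 'v set" and V :: "'v set" and E :: "'x set" and u v :: 'v and F :: "'x set"
  assumes wf: "wf_graph ep V E" and biconn: "biconnected ep V E" and sep: "sep_union ep V E u v F"
begin

lemma sep_union_facts:
  shows uv: "u \<noteq> v" "u \<in> V" "v \<in> V" and FE: "F \<subseteq> E"
    and card_F: "2 \<le> card F" and card_compl: "2 \<le> card (E - F)"
  using sep by (auto simp: sep_union_def)

lemma local_closed:
  "e \<in> F \<Longrightarrow> f \<in> E \<Longrightarrow> x \<in> ep e \<Longrightarrow> x \<in> ep f \<Longrightarrow> x \<noteq> u \<Longrightarrow> x \<noteq> v \<Longrightarrow> f \<in> F"
  using sep sep_union_iff[OF wf] by blast

lemma finite_E: "finite E" using wf by (simp add: wf_graph_def)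

text \<open>Together with \<open>swap\<close> this gives the symmetries under which facts are proved
  for the side \<open>F\<close> and the end \<open>u\<close> only.\<close>

lemma compl: "separation ep V E u v (E - F)"
proof
  have "E - (E - F) = F" using FE by auto
  then show "sep_union ep V E u v (E - F)"
    unfolding sep_union_iff[OF wf] using uv FE card_F card_compl local_closed by auto
qed (fact wf, fact biconn)

lemma swap: "separation ep V E v u F"
proof
  show "sep_union ep V E v u F"
    using sep unfolding sep_union_iff[OF wf] by auto
qed (fact wf, fact biconn)

text \<open>Biconnectivity yields a walk from \<open>u\<close> to \<open>z\<close> avoiding
  \<open>v\<close>. Read backwards from \<open>z\<close>, it stays in \<open>F\<close> until it
  first meets \<open>u\<close>, since at every vertex outside the pair all edges lie on the same
  side.\<close>

lemma walk_in_side: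
  assumes "z \<in> V" "z \<noteq> v" "z \<in> \<Union> (ep ` F)"
  shows "(step ep (V - {v}) F)\<^sup>*\<^sup>* z u"
proof -
  have conn: "(step ep (V - {v}) E)\<^sup>*\<^sup>* u z"
    using biconn assms uv by (auto simp: biconnected_iff connected_graph_iff_steps)
  have "x \<in> \<Union> (ep ` F) \<Longrightarrow> (step ep (V - {v}) F)\<^sup>*\<^sup>* x u"
    if "(step ep (V - {v}) E)\<^sup>*\<^sup>* u x" for x
    using that
  proof (induction rule: rtranclp_induct)
    case (step p q)
    then obtain f where f: "f \<in> E" "ep f = {p, q}" "p \<in> V - {v}" "q \<in> V - {v}"
      by (auto simp: step_def)
    show ?case
    proof (cases "q = u")
      case False
      from step.prems obtain g where "g \<in> F" "q \<in> ep g" by auto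
      then have fF: "f \<in> F" using local_closed[of g f q] f False by auto
      then have "step ep (V - {v}) F q p" using f by (auto simp: step_def insert_commute)
      moreover have "p \<in> \<Union> (ep ` F)" using fF f by auto
      ultimately show ?thesis using step.IH by (meson converse_rtranclp_into_rtranclp)
    qed simp
  qed simp
  then show ?thesis using conn assms by blast
qed

lemma inner_edge_end:
  assumes "f \<in> E" "ep f \<noteq> {u, v}"
  obtains z where "z \<in> ep f" "z \<noteq> u" "z \<noteq> v" "z \<in> V"
proof -
  have "card (ep f) = 2" "ep f \<subseteq> V" using wf assms by (auto simp: wf_graph_def)
  then obtain p q where "ep f = {p, q}" "p \<noteq> q" "p \<in> V" "q \<in> V" by (auto simp: card_2_iff)
  with assms that show thesis by (metis doubleton_eq_iff insertCI)
qed

text \<open>An edge of \<open>F\<close> either joins \<open>u\<close> and \<open>v\<close> or has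
  another end, and from there the last step of a walk to \<open>u\<close> inside \<open>F\<close> is
  an edge at \<open>u\<close>.\<close>

lemma side_meets_u: "\<exists>f\<in>F. u \<in> ep f"
proof -
  obtain f where f: "f \<in> F" using card_F by fastforce
  show ?thesis
  proof (cases "ep f = {u, v}")
    case False
    obtain z where z: "z \<in> ep f" "z \<noteq> u" "z \<noteq> v" "z \<in> V"
      using inner_edge_end[of f] False FE f by blast
    then have "(step ep (V - {v}) F)\<^sup>*\<^sup>* z u" using walk_in_side f by blast
    then obtain y where "step ep (V - {v}) F y u" using z(2) by (metis rtranclp.cases)
    then show ?thesis by (auto simp: step_def)
  qed (use f in auto)
qed

lemma verts_Int: "x \<in> \<Union> (ep ` F) \<Longrightarrow> x \<in> \<Union> (ep ` (E - F)) \<Longrightarrow> x \<in> {u, v}"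
  using local_closed by auto

lemma verts_cover: "\<Union> (ep ` F) \<union> \<Union> (ep ` (E - F)) = V"
proof -
  have "\<exists>f\<in>E. x \<in> ep f" if "x \<in> V" for x
  proof -
    obtain y where y: "y \<in> V" "y \<noteq> x" using uv by metis
    then have "(step ep V E)\<^sup>*\<^sup>* x y"
      using biconn that by (auto simp: biconnected_iff connected_graph_iff_steps)
    then obtain z where "step ep V E x z" using y by (metis converse_rtranclpE)
    then show ?thesis by (auto simp: step_def)
  qed
  moreover have "ep f \<subseteq> V" if "f \<in> E" for f using that wf by (auto simp: wf_graph_def)
  ultimately have "\<Union> (ep ` E) = V" by auto
  moreover have "E = F \<union> (E - F)" using FE by auto
  ultimately show ?thesis by (metis Union_Un_distrib image_Un)
qed

lemma side_meets_v: "\<exists>f\<in>F. v \<in> ep f"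
  using separation.side_meets_u[OF swap] .

text \<open>The two sides cover \<open>V\<close> and share exactly \<open>u\<close> and
  \<open>v\<close>. This is the source of the summand 2 in \<open>weight\<close>.\<close>

lemma card_verts:
  "card (\<Union> (ep ` F) \<union> {u, v}) + card (\<Union> (ep ` (E - F)) \<union> {u, v}) = card V + 2"
proof -
  have "finite V" using wf by (simp add: wf_graph_def)
  let ?A = "\<Union> (ep ` F) \<union> {u, v}" and ?B = "\<Union> (ep ` (E - F)) \<union> {u, v}"
  have AB: "?A \<union> ?B = V" using verts_cover uv by blast
  have I: "?A \<inter> ?B = {u, v}" using verts_Int by blast
  have "finite ?A" "finite ?B" using AB \<open>finite V\<close> by (metis finite_Un)+
  then have "card ?A + card ?B = card (?A \<union> ?B) + card (?A \<inter> ?B)" by (rule card_Un_Int)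
  then show ?thesis unfolding AB I using uv by simp
qed

lemma degree_split: "degree ep E a = degree ep F a + degree ep (E - F) a"
proof -
  have "{f\<in>E. a \<in> ep f} = {f\<in>F. a \<in> ep f} \<union> {f\<in>E - F. a \<in> ep f}" using FE by auto
  then show ?thesis unfolding degree_def
    using finite_E FE by (subst card_Un_disjoint[symmetric]) (auto intro: finite_subset)
qed

lemma degree_side_pos:
  assumes "a \<in> {u, v}"
  shows "1 \<le> degree ep F a"
proof -
  have "{f\<in>F. a \<in> ep f} \<noteq> {}" using assms side_meets_u side_meets_v by auto
  moreover have "finite F" using finite_E FE by (rule rev_finite_subset)
  ultimately show ?thesis unfolding degree_def by (simp add: Suc_le_eq card_gt_0_iff)
qed

lemma degree_compl_inner:
  assumes "e \<in> F" "a \<in> ep e" "a \<notin> {u, v}"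
  shows "degree ep (E - F) a = 0"
proof -
  have none: "{f\<in>E - F. a \<in> ep f} = {}" using local_closed assms by auto
  show ?thesis unfolding degree_def none by simp
qed

text \<open>Once \<open>v\<close> and \<open>e\<close> are removed, nothing leads from
  \<open>u\<close> out of the side \<open>F\<close>, while \<open>walk_in_side\<close> connects all
  of this side to \<open>u\<close>. Hence the component of \<open>u\<close> consists of the vertices
  of \<open>F\<close> other than \<open>v\<close> and \<open>u\<close> itself.\<close>

lemma is_25split_if_single:
  assumes one: "{f\<in>E - F. u \<in> ep f} = {e}"
  shows "ves ep V E v e" "u \<in> ep e" "side_edges ep V E v e u = F"
proof -
  have e: "e \<in> E" "e \<notin> F" "u \<in> ep e" using one by auto
  then obtain b where b: "ep e = {u, b}" "b \<noteq> u" "b \<in> V" using wf_edge_ends[OF wf] by metis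
  \<comment> \<open>If \<open>e\<close> joined \<open>u\<close> and \<open>v\<close>, another edge
    of \<open>E - F\<close> would have an end outside the pair, and a walk from there to
    \<open>u\<close> avoiding \<open>v\<close> would end with a second edge at \<open>u\<close> in
    \<open>E - F\<close>.\<close>
  have bv: "b \<noteq> v"
  proof
    assume bv: "b = v"
    have "E - F \<noteq> {e}" using card_compl by auto
    moreover have "e \<in> E - F" using e by simp
    ultimately obtain f where f: "f \<in> E - F" "f \<noteq> e" by blast
    then have "u \<notin> ep f" using one by blast
    then have "f \<in> E" "ep f \<noteq> {u, v}" using f by blast+
    then obtain z where z: "z \<in> ep f" "z \<noteq> u" "z \<noteq> v" "z \<in> V"
      by (rule inner_edge_end)
    then have "(step ep (V - {v}) (E - F))\<^sup>*\<^sup>* z u"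
      using separation.walk_in_side[OF compl] f by blast
    then obtain y where "step ep (V - {v}) (E - F) y u" using z(2) by (metis rtranclp.cases)
    then obtain g where "g \<in> E - F" "ep g = {y, u}" "y \<noteq> v" unfolding step_def by blast
    then have "g = e" using one by blast
    with \<open>ep g = {y, u}\<close> \<open>y \<noteq> v\<close> b bv show False by (auto simp: doubleton_eq_iff)
  qed
  let ?S = "step ep (V - {v}) {f \<in> E - {e}. v \<notin> ep f}"
  have comp: "comp_of ep V E v e u = (\<Union> (ep ` F) \<union> {u}) - {v}"
  proof
    have "x \<in> (\<Union> (ep ` F) \<union> {u}) - {v}" if "?S\<^sup>*\<^sup>* u x" for x
      using that
    proof (induction rule: rtranclp_induct)
      case base
      then show ?case using uv by simp
    next
      case (step p q)
      then obtain f where f: "f \<in> E" "f \<noteq> e" "ep f = {p, q}" "q \<noteq> v"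
        by (auto simp: step_def)
      have "f \<in> F"
      proof (cases "p = u")
        case True
        then show ?thesis using one f by auto
      next
        case False
        then show ?thesis using step.IH local_closed[of _ f p] f by auto
      qed
      then show ?case using f by auto
    qed
    then show "comp_of ep V E v e u \<subseteq> (\<Union> (ep ` F) \<union> {u}) - {v}"
      by (auto simp: comp_of_def reachable_iff_steps)
  next
    \<comment> \<open>Walks from \<open>walk_in_side\<close> lead towards \<open>u\<close>, whereas
      \<open>comp_of\<close> starts there; hence the reversal.\<close>
    have st: "?S y x" if "step ep (V - {v}) F x y" for x y
      using that FE e(2) by (auto simp: step_def insert_commute)
    have rev: "?S\<^sup>*\<^sup>* y x" if "(step ep (V - {v}) F)\<^sup>*\<^sup>* x y" for x y
      using that
      by (induction rule: rtranclp_induct) (blast intro: converse_rtranclp_into_rtranclp st)+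
    show "(\<Union> (ep ` F) \<union> {u}) - {v} \<subseteq> comp_of ep V E v e u"
    proof
      fix x assume x: "x \<in> (\<Union> (ep ` F) \<union> {u}) - {v}"
      have "?S\<^sup>*\<^sup>* u x"
      proof (cases "x = u")
        case False
        then have "x \<in> V" "x \<noteq> v" "x \<in> \<Union> (ep ` F)" using x verts_cover by blast+
        then show ?thesis by (intro rev walk_in_side)
      qed simp
      then show "x \<in> comp_of ep V E v e u"
        using uv by (simp add: comp_of_def reachable_iff_steps)
    qed
  qed
  show side: "side_edges ep V E v e u = F"
  proof
    show "side_edges ep V E v e u \<subseteq> F"
    proof
      fix f assume "f \<in> side_edges ep V E v e u"
      then have f: "f \<in> E" "ep f \<subseteq> \<Union> (ep ` F) \<union> {u, v}"
        using comp by (auto simp: side_edges_def)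
      show "f \<in> F"
      proof (cases "ep f = {u, v}")
        case True
        then have "f \<noteq> e" using b bv by (auto simp: doubleton_eq_iff)
        then show ?thesis using one f(1) True by blast
      next
        case False
        with f(1) obtain z where "z \<in> ep f" "z \<noteq> u" "z \<noteq> v" by (rule inner_edge_end)
        moreover from this obtain g where "g \<in> F" "z \<in> ep g" using f(2) by blast
        ultimately show ?thesis using f(1) local_closed by blast
      qed
    qed
    show "F \<subseteq> side_edges ep V E v e u"
      using FE comp by (auto simp: side_edges_def)
  qed
  have "b \<notin> \<Union> (ep ` F)"
    using verts_Int[of b] b bv e by auto
  then have "b \<notin> comp_of ep V E v e u" using comp b by auto
  then have "\<not> connected_graph ep (V - {v}) {f \<in> E - {e}. v \<notin> ep f}"
    using b bv uv by (auto simp: comp_of_def reachable_iff_steps connected_graph_iff_steps)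
  moreover have "\<not> triangle ep V E"
  proof -
    have "card E = card F + card (E - F)"
      using finite_E FE by (metis card_Diff_subset card_mono finite_subset le_add_diff_inverse)
    then show ?thesis using card_F card_compl by (auto simp: triangle_def)
  qed
  ultimately show "ves ep V E v e" using biconn uv e by (simp add: ves_def)
  show "u \<in> ep e" by fact
qed

end

text \<open>The graph without \<open>c\<close> is connected, so the removal of \<open>e\<close>
  disconnects it only if \<open>e\<close> misses \<open>c\<close> and its two ends fall apart. The
  far end of \<open>e\<close> is then outside the component of \<open>a\<close>, while every other
  edge at \<open>a\<close> leads to \<open>c\<close> or into that component.\<close>

lemma single_if_is_25split:
  assumes wf: "wf_graph ep V E" and "ves ep V E c e" "a \<in> ep e"
  shows "a \<noteq> c" "{f\<in>E - side_edges ep V E c e a. a \<in> ep f} = {e}"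
proof -
  have bic: "biconnected ep V E" and c: "c \<in> V" and e: "e \<in> E"
    and nc: "\<not> connected_graph ep (V - {c}) {f \<in> E - {e}. c \<notin> ep f}"
    using assms by (auto simp: ves_def)
  let ?S = "step ep (V - {c}) {f \<in> E - {e}. c \<notin> ep f}"
  have conn: "connected_graph ep (V - {c}) E" using bic c by (simp add: biconnected_iff)
  obtain b where b: "ep e = {a, b}" "b \<noteq> a" "a \<in> V" "b \<in> V"
    using wf_edge_ends[OF wf e assms(3)] by metis
  have sym: "?S\<^sup>*\<^sup>* y x" if "?S\<^sup>*\<^sup>* x y" for x y
    using that by (induction rule: rtranclp_induct)
      (auto simp: step_def insert_commute intro: converse_rtranclp_into_rtranclp)
  have nab: "\<not> (c \<in> ep e \<or> ?S\<^sup>*\<^sup>* a b)"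
  proof
    assume H: "c \<in> ep e \<or> ?S\<^sup>*\<^sup>* a b"
    have st: "?S\<^sup>*\<^sup>* x y" if xy: "step ep (V - {c}) E x y" for x y
    proof -
      obtain f where f: "f \<in> E" "ep f = {x, y}" "x \<in> V - {c}" "y \<in> V - {c}"
        using xy by (auto simp: step_def)
      show ?thesis
      proof (cases "f = e")
        case True
        then have "?S\<^sup>*\<^sup>* a b" using H f by auto
        then show ?thesis using True f b sym by (auto simp: doubleton_eq_iff)
      next
        case False
        then have "?S x y" using f by (auto simp: step_def)
        then show ?thesis by simp
      qed
    qed
    have "?S\<^sup>*\<^sup>* x y" if "(step ep (V - {c}) E)\<^sup>*\<^sup>* x y" for x y
      using that by (induction rule: rtranclp_induct) (blast intro: rtranclp_trans st)+
    with conn nc show False by (auto simp: connected_graph_iff_steps)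
  qed
  show ac: "a \<noteq> c" using nab assms(3) by auto
  have "b \<notin> comp_of ep V E c e a \<union> {c}" using nab b by (auto simp: comp_of_def reachable_iff_steps)
  then have "e \<notin> side_edges ep V E c e a" using b by (auto simp: side_edges_def)
  moreover have "f \<in> side_edges ep V E c e a" if f: "f \<in> E" "a \<in> ep f" "f \<noteq> e" for f
  proof -
    obtain z where z: "ep f = {a, z}" "z \<in> V" using wf_edge_ends[OF wf f(1,2)] by metis
    have "z \<noteq> c \<Longrightarrow> ?S a z" using f z ac b by (auto simp: step_def)
    then show ?thesis using f z ac b
      by (auto simp: side_edges_def comp_of_def reachable_iff_steps)
  qed
  ultimately show "{f\<in>E - side_edges ep V E c e a. a \<in> ep f} = {e}"
    using e assms(3) by auto
qed

context separation
begin

text \<open>Turns the case distinction of the colouring rules into a count of edges at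
  \<open>u\<close> and \<open>v\<close>. The four possibilities are one case, \<open>aux\<close>,
  seen through \<open>compl\<close> and \<open>swap\<close>.\<close>

lemma is_25split_iff:
  "(\<exists>c a. is_25split ep V E c e a u v F) \<longleftrightarrow>
     (\<exists>a\<in>{u, v}. {f\<in>F. a \<in> ep f} = {e} \<or> {f\<in>E - F. a \<in> ep f} = {e})" (is "?L \<longleftrightarrow> ?R")
proof
  assume ?L
  then obtain c a where s: "ves ep V E c e" "a \<in> ep e" "{u, v} = {a, c}"
    "F = side_edges ep V E c e a \<or> F = E - side_edges ep V E c e a"
    by (auto simp: is_25split_def)
  moreover have "side_edges ep V E c e a \<subseteq> E" by (auto simp: side_edges_def)
  ultimately show ?R using single_if_is_25split(2)[OF wf s(1,2)] by (metis insertI1)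
next
  have aux: "\<exists>c a. is_25split ep V E c e a u v F"
    if "separation ep V E x y F'" "{x, y} = {u, v}" "F' = F \<or> F' = E - F"
      "{f\<in>E - F'. x \<in> ep f} = {e}" for x y F'
  proof -
    interpret S: separation ep V E x y F' by fact
    have "F = F' \<or> F = E - F'" using that(3) FE by blast
    then have "is_25split ep V E y e x u v F"
      unfolding is_25split_def S.is_25split_if_single(3)[OF that(4)]
      using S.is_25split_if_single(1,2)[OF that(4)] S.card_F that(2) by simp
    then show ?thesis by blast
  qed
  have EF: "E - (E - F) = F" using FE by auto
  have sw: "{v, u} = {u, v}" by auto
  assume ?R
  then consider "{f\<in>F. u \<in> ep f} = {e}" | "{f\<in>E - F. u \<in> ep f} = {e}"
    | "{f\<in>F. v \<in> ep f} = {e}" | "{f\<in>E - F. v \<in> ep f} = {e}" by blast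
  then show ?L
  proof cases
    case 1
    then show ?thesis using aux[OF compl] by (simp add: EF)
  next
    case 2
    then show ?thesis using aux[OF separation_axioms] by simp
  next
    case 3
    then show ?thesis using aux[OF separation.swap[OF compl] sw] by (simp add: EF)
  next
    case 4
    then show ?thesis using aux[OF swap sw] by simp
  qed
qed

end

section \<open>Pieces of a split and ears\<close>

text \<open>The relation holds between \<open>e\<close> and itself as soon as \<open>e\<close> has
  an end of degree 2. Later conditions such as \<open>e \<noteq> e0\<close> discard this reflexive
  case.\<close>

definition ear_adj :: "('x \<Rightarrow> 'v set) \<Rightarrow> 'x set \<Rightarrow> 'x \<Rightarrow> 'x \<Rightarrow> bool" where
  "ear_adj ep E e f \<longleftrightarrow> e \<in> E \<and> f \<in> E \<and> (\<exists>a. a \<in> ep e \<and> a \<in> ep f \<and> degree ep E a = 2)"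

lemma ear_adj_cong:
  assumes "\<And>f. f \<in> E \<Longrightarrow> ep' f = ep f"
  shows "ear_adj ep' E = ear_adj ep E"
  using assms degree_cong[of E ep' ep, OF assms] by (auto simp: ear_adj_def fun_eq_iff)

lemma ear_adj_sym: "ear_adj ep E e f \<Longrightarrow> ear_adj ep E f e"
  by (auto simp: ear_adj_def)

lemma ear_class_sym: "(ear_adj ep E)\<^sup>*\<^sup>* e f \<Longrightarrow> (ear_adj ep E)\<^sup>*\<^sup>* f e"
  by (induction rule: rtranclp_induct) (auto intro: converse_rtranclp_into_rtranclp ear_adj_sym)

lemma ear_class_subset: "(ear_adj ep E)\<^sup>*\<^sup>* e f \<Longrightarrow> e \<in> E \<Longrightarrow> f \<in> E"
  by (induction rule: rtranclp_induct) (auto simp: ear_adj_def)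

locale split_piece = separation ep V E u v F
  for ep :: "'x \<Rightarrow> 'v set" and V E u v F +
  fixes e0 :: 'x
  assumes new: "e0 \<notin> E" and ep_new: "ep e0 = {u, v}"
begin

abbreviation "PV \<equiv> \<Union> (ep ` F) \<union> {u, v}"
abbreviation "PE \<equiv> insert e0 F"

lemma new_F: "e0 \<notin> F" using new FE by auto

lemma finite_F: "finite F" using finite_E FE by (rule rev_finite_subset)

lemma PV_subset: "PV \<subseteq> V" using verts_cover uv by blast

lemma wf_piece: "wf_graph ep PV PE"
  using wf FE finite_F uv PV_subset
  by (auto simp: wf_graph_def ep_new intro: finite_subset)

lemma card_piece: "3 \<le> card PE" using card_F new_F finite_F by simp

text \<open>A walk of the whole graph leaves and reenters the piece only through \<open>u\<close>
  and \<open>v\<close>, and such a detour is replaced by \<open>e0\<close>. While the walk is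
  outside, the induction remembers an end \<open>p\<close> of the pair already reached. A general
  \<open>W\<close> serves both conditions of \<open>biconnected_iff\<close>.\<close>

lemma connected_piece_minus:
  assumes "connected_graph ep (V - W) E"
  shows "connected_graph ep (PV - W) PE"
  unfolding connected_graph_iff_steps
proof (intro ballI)
  fix x y assume x: "x \<in> PV - W" and y: "y \<in> PV - W"
  let ?S = "step ep (PV - W) PE"
  have "(step ep (V - W) E)\<^sup>*\<^sup>* x y"
    using assms x y PV_subset by (auto simp: connected_graph_iff_steps)
  then have "y \<notin> W \<and> (y \<in> PV \<longrightarrow> ?S\<^sup>*\<^sup>* x y) \<and> (y \<notin> PV \<longrightarrow> (\<exists>p\<in>{u, v} - W. ?S\<^sup>*\<^sup>* x p))"
  proof (induction rule: rtranclp_induct)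
    case base
    then show ?case using x by simp
  next
    case (step y z)
    then obtain f where f: "f \<in> E" "ep f = {y, z}" "y \<notin> W" "z \<notin> W"
      unfolding step_def by blast
    show ?case
    proof (cases "f \<in> F")
      case True
      then have "y \<in> PV - W" "z \<in> PV - W" using f by auto
      then have "?S y z" using f True by (auto simp: step_def)
      then show ?thesis using step.IH \<open>y \<in> PV - W\<close> \<open>z \<in> PV - W\<close>
        by (auto intro: rtranclp.rtrancl_into_rtrancl)
    next
      case False
      then have out: "y \<in> \<Union> (ep ` (E - F))" "z \<in> \<Union> (ep ` (E - F))" using f by auto
      have "\<exists>p\<in>{u, v} - W. ?S\<^sup>*\<^sup>* x p"
      proof (cases "y \<in> PV")
        case True
        then have "y \<in> {u, v}" using verts_Int out by blast
        then show ?thesis using step.IH True f(3) by blast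
      qed (use step.IH in blast)
      then obtain p where p: "p \<in> {u, v} - W" "?S\<^sup>*\<^sup>* x p" by blast
      have "?S\<^sup>*\<^sup>* x z" if "z \<in> PV"
      proof (cases "p = z")
        case False
        have "z \<in> {u, v}" using verts_Int out that by blast
        then have "ep e0 = {p, z}" using ep_new p False by auto
        then have "?S p z" using p that f(4) by (auto simp: step_def)
        then show ?thesis using p by (auto intro: rtranclp.rtrancl_into_rtrancl)
      qed (use p in simp)
      then show ?thesis using p f(4) by blast
    qed
  qed
  then show "?S\<^sup>*\<^sup>* x y" using y by blast
qed

lemma biconnected_piece: "biconnected ep PV PE"
proof -
  have "connected_graph ep (V - {}) E" using biconn by (simp add: biconnected_iff)
  from connected_piece_minus[OF this] have "connected_graph ep PV PE" by simp
  moreover have "connected_graph ep (PV - {w}) PE" if "w \<in> PV" for w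
    using that PV_subset biconn by (intro connected_piece_minus) (auto simp: biconnected_iff)
  ultimately show ?thesis by (simp add: biconnected_iff)
qed

lemma degree_piece: "degree ep PE a = (if a \<in> {u, v} then Suc (degree ep F a) else degree ep F a)"
proof (cases "a \<in> {u, v}")
  case True
  then have "{f \<in> PE. a \<in> ep f} = insert e0 {f \<in> F. a \<in> ep f}" using ep_new by auto
  then show ?thesis using True new_F finite_F by (simp add: degree_def)
next
  case False
  then have "{f \<in> PE. a \<in> ep f} = {f \<in> F. a \<in> ep f}" using ep_new by auto
  then show ?thesis using False by (simp only: degree_def if_False)
qed

text \<open>At \<open>u\<close> and \<open>v\<close> the new edge is paid for by at least one edge
  of the other side.\<close>

lemma degree_piece_le: "degree ep PE a \<le> degree ep E a"
  using degree_piece[of a] degree_split[of a] separation.degree_side_pos[OF compl, of a]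
  by (cases "a \<in> {u, v}") auto

lemma degree_piece_single:
  assumes "a \<in> {u, v}"
  shows "degree ep PE a = 2 \<longleftrightarrow> (\<exists>e. {f\<in>F. a \<in> ep f} = {e})"
proof -
  have "degree ep PE a = 2 \<longleftrightarrow> degree ep F a = 1" using assms by (simp add: degree_piece)
  then show ?thesis unfolding degree_def by (simp add: card_1_singleton_iff)
qed

text \<open>The right-hand side is the contribution of one side to \<open>is_25split_iff\<close>: an
  end of the pair has degree 2 in the piece iff \<open>e0\<close> meets a single old edge
  there.\<close>

lemma ear_adj_new_iff:
  "ear_adj ep PE e0 e \<and> e \<noteq> e0 \<longleftrightarrow> (\<exists>a\<in>{u, v}. {f\<in>F. a \<in> ep f} = {e})" (is "?L \<longleftrightarrow> ?R")
proof
  assume L: ?L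
  then obtain a where a: "a \<in> {u, v}" "a \<in> ep e" "degree ep PE a = 2" "e \<in> F"
    using ep_new by (auto simp: ear_adj_def)
  then obtain g where "{f\<in>F. a \<in> ep f} = {g}" using degree_piece_single by blast
  moreover have "e \<in> {f\<in>F. a \<in> ep f}" using a by simp
  ultimately have "{f\<in>F. a \<in> ep f} = {e}" by simp
  then show ?R using a(1) by blast
next
  assume ?R
  then obtain a where a: "a \<in> {u, v}" "{f\<in>F. a \<in> ep f} = {e}" by blast
  then have "degree ep PE a = 2" using degree_piece_single by blast
  moreover have "e \<in> F" "a \<in> ep e" using a by blast+
  ultimately show ?L using a ep_new new_F by (auto simp: ear_adj_def)
qed

text \<open>A degree of 2 at \<open>u\<close> or \<open>v\<close> in the piece leaves room for only
  one old edge, so two old edges adjacent there coincide. Elsewhere the degree equals that in the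
  old graph.\<close>

lemma ear_adj_piece_old:
  assumes "ear_adj ep PE x y" "x \<noteq> e0" "y \<noteq> e0"
  shows "x = y \<or> ear_adj ep E x y"
proof -
  from assms obtain a where a: "x \<in> F" "y \<in> F" "a \<in> ep x" "a \<in> ep y" "degree ep PE a = 2"
    by (auto simp: ear_adj_def)
  show ?thesis
  proof (cases "a \<in> {u, v}")
    case True
    then obtain e where "{f\<in>F. a \<in> ep f} = {e}" using a degree_piece_single by blast
    moreover have "x \<in> {f\<in>F. a \<in> ep f}" "y \<in> {f\<in>F. a \<in> ep f}" using a by simp_all
    ultimately show ?thesis by simp
  next
    case False
    then have "degree ep E a = 2"
      using degree_piece degree_split degree_compl_inner a by simp
    then show ?thesis using a FE by (auto simp: ear_adj_def)
  qed
qed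

lemma ear_adj_old_piece:
  assumes "ear_adj ep E x y" "x \<in> F" and deg: "\<And>a. a \<in> {u, v} \<Longrightarrow> degree ep E a \<noteq> 2"
  shows "y \<in> F \<and> ear_adj ep PE x y"
proof -
  from assms(1) obtain a where a: "y \<in> E" "a \<in> ep x" "a \<in> ep y" "degree ep E a = 2"
    by (auto simp: ear_adj_def)
  then have na: "a \<notin> {u, v}" using deg by blast
  then have y: "y \<in> F" using local_closed[OF assms(2) a(1-3)] by simp
  have "degree ep PE a = 2"
    using na degree_piece degree_split degree_compl_inner[OF assms(2) a(2) na] a(4) by simp
  then show ?thesis using y assms(2) a by (auto simp: ear_adj_def)
qed

lemma ear_class_old_piece:
  assumes "(ear_adj ep E)\<^sup>*\<^sup>* x y" "x \<in> F" "\<And>a. a \<in> {u, v} \<Longrightarrow> degree ep E a \<noteq> 2"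
  shows "y \<in> F \<and> (ear_adj ep PE)\<^sup>*\<^sup>* x y"
  using assms(1)
proof (induction rule: rtranclp_induct)
  case (step y z)
  then show ?case using ear_adj_old_piece[of y z] assms(3) by (auto intro: rtranclp.rtrancl_into_rtrancl)
qed (use assms(2) in simp)

text \<open>The chain is cut after its last visit to \<open>e0\<close>: what follows begins at a
  neighbour of \<open>e0\<close> and uses old edges only.\<close>

lemma ear_class_piece_old:
  assumes "(ear_adj ep PE)\<^sup>*\<^sup>* x y" "x \<in> PE" "y \<noteq> e0"
  shows "(x \<noteq> e0 \<and> (ear_adj ep E)\<^sup>*\<^sup>* x y) \<or>
    (\<exists>e. ear_adj ep PE e0 e \<and> e \<noteq> e0 \<and> (ear_adj ep E)\<^sup>*\<^sup>* e y)"
  using assms(1,2)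
proof (induction rule: converse_rtranclp_induct)
  case base
  then show ?case using assms(3) by simp
next
  case (step x z)
  have "z \<in> PE" using step.hyps by (auto simp: ear_adj_def)
  with step.IH consider "z \<noteq> e0" "(ear_adj ep E)\<^sup>*\<^sup>* z y"
    | "\<exists>e. ear_adj ep PE e0 e \<and> e \<noteq> e0 \<and> (ear_adj ep E)\<^sup>*\<^sup>* e y" by blast
  then show ?case
  proof cases
    case 1
    show ?thesis
    proof (cases "x = e0")
      case True
      then show ?thesis using 1 step.hyps by blast
    next
      case False
      then have "x = z \<or> ear_adj ep E x z" using ear_adj_piece_old 1 step.hyps by blast
      then have "(ear_adj ep E)\<^sup>*\<^sup>* x y" using 1 by (auto intro: converse_rtranclp_into_rtranclp)
      then show ?thesis using False by blast
    qed
  qed blast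
qed

lemma ear_class_piece_avoiding:
  assumes "(ear_adj ep PE)\<^sup>*\<^sup>* x y" "x \<in> PE" "\<not> (ear_adj ep PE)\<^sup>*\<^sup>* e0 x"
  shows "(ear_adj ep E)\<^sup>*\<^sup>* x y"
proof -
  have nx: "\<not> (ear_adj ep PE)\<^sup>*\<^sup>* x e0" using assms(3) ear_class_sym by metis
  from assms(1) show ?thesis
  proof (induction rule: rtranclp_induct)
    case (step y z)
    have "y \<noteq> e0" "z \<noteq> e0" using nx step.hyps by (auto intro: rtranclp.rtrancl_into_rtrancl)
    then have "y = z \<or> ear_adj ep E y z" using ear_adj_piece_old step.hyps by blast
    then show ?case using step.IH by (auto intro: rtranclp.rtrancl_into_rtrancl)
  qed simp
qed

end

section \<open>Ears coincide with the classes of ear-adjacency\<close>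

lemma ear_edges_in_class:
  assumes "ear_candidate ep V E e vs es" "f \<in> set es"
  shows "(ear_adj ep E)\<^sup>*\<^sup>* e f"
proof -
  have p: "is_path ep V E vs es" "e \<in> set es"
    and deg: "\<And>x. x \<in> internal_vertices vs es \<Longrightarrow> degree ep E x = 2"
    using assms by (auto simp: ear_candidate_def)
  have ends: "\<forall>i<length es. ep (es ! i) = {vs ! i, vs ! Suc i}" and esE: "set es \<subseteq> E"
    using p by (auto simp: is_path_def)
  have adj: "ear_adj ep E (es ! i) (es ! Suc i)" if i: "Suc i < length es" for i
  proof -
    have "degree ep E (vs ! Suc i) = 2" using i by (intro deg) (auto simp: internal_vertices_def)
    moreover have "vs ! Suc i \<in> ep (es ! i)" "vs ! Suc i \<in> ep (es ! Suc i)" using ends i by auto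
    moreover have "es ! i \<in> E" "es ! Suc i \<in> E" using esE i by auto
    ultimately show ?thesis by (auto simp: ear_adj_def)
  qed
  have all: "(ear_adj ep E)\<^sup>*\<^sup>* (es ! 0) (es ! i)" if "i < length es" for i
    using that
  proof (induction i)
    case (Suc i)
    then show ?case using adj by (meson Suc_lessD rtranclp.rtrancl_into_rtrancl)
  qed simp
  from p assms(2) obtain i j where "i < length es" "es ! i = e" "j < length es" "es ! j = f"
    by (auto simp: in_set_conv_nth)
  then show ?thesis using all ear_class_sym by (metis rtranclp_trans)
qed

lemma degree_two_cases:
  assumes "degree ep E a = 2" "e \<in> E" "f \<in> E" "g \<in> E" "a \<in> ep e" "a \<in> ep f" "a \<in> ep g" "e \<noteq> f"
  shows "g = e \<or> g = f"
proof (rule ccontr)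
  assume "\<not> ?thesis"
  then have "card {e, f, g} = 3" using assms by auto
  moreover have "finite {h \<in> E. a \<in> ep h}" using assms(1) by (metis card.infinite degree_def zero_neq_numeral)
  then have "card {e, f, g} \<le> degree ep E a" unfolding degree_def using assms by (intro card_mono) auto
  ultimately show False using assms(1) by simp
qed

text \<open>Ears will be extended at their first vertex only; reversal covers the last one.\<close>

lemma is_path_rev:
  assumes "is_path ep V E vs es"
  shows "is_path ep V E (rev vs) (rev es)"
proof -
  have len: "length vs = Suc (length es)" and ends: "\<forall>i<length es. ep (es ! i) = {vs ! i, vs ! Suc i}"
    and d: "distinct vs \<or> (hd vs = last vs \<and> distinct (tl vs))"
    using assms by (auto simp: is_path_def)
  have "ep (rev es ! i) = {rev vs ! i, rev vs ! Suc i}" if i: "i < length es" for i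
  proof -
    let ?j = "length es - Suc i"
    have "rev es ! i = es ! ?j" "rev vs ! i = vs ! Suc ?j" "rev vs ! Suc i = vs ! ?j"
      using i len by (auto simp: rev_nth Suc_diff_Suc)
    moreover have "ep (es ! ?j) = {vs ! ?j, vs ! Suc ?j}" using ends i by auto
    ultimately show ?thesis by auto
  qed
  moreover have "distinct (rev vs) \<or> (hd (rev vs) = last (rev vs) \<and> distinct (tl (rev vs)))"
  proof (cases "distinct vs")
    case False
    then have c: "hd vs = last vs" "distinct (tl vs)" using d by auto
    obtain x ys where vs: "vs = x # ys" using len by (cases vs) auto
    then have ys: "ys \<noteq> []" using False by auto
    then have ysb: "ys = butlast ys @ [x]" using c vs by (metis append_butlast_last_id last_ConsR list.sel(1))
    then obtain zs where zs: "ys = zs @ [x]" by blast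
    then show ?thesis using c vs by auto
  qed simp
  ultimately show ?thesis using assms len by (auto simp: is_path_def)
qed

lemma internal_vertices_rev:
  assumes "length vs = Suc (length es)"
  shows "internal_vertices (rev vs) (rev es) = internal_vertices vs es"
proof -
  have sub: "internal_vertices (rev vs) (rev es) \<subseteq> internal_vertices vs es"
    if len: "length vs = Suc (length es)" for vs :: "'c list" and es :: "'d list"
  proof
    fix x assume "x \<in> internal_vertices (rev vs) (rev es)"
    then obtain i where i: "x = rev vs ! i" "0 < i" "i < length es" by (auto simp: internal_vertices_def)
    then have "x = vs ! (length es - i)" using len by (simp add: rev_nth)
    then show "x \<in> internal_vertices vs es" using i by (auto simp: internal_vertices_def)
  qed
  show ?thesis using sub[OF assms] sub[of "rev vs" "rev es"] assms by auto
qed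

lemma ear_candidate_rev:
  assumes "ear_candidate ep V E e vs es"
  shows "ear_candidate ep V E e (rev vs) (rev es)"
proof -
  have "length vs = Suc (length es)" using assms by (simp add: ear_candidate_def is_path_def)
  then show ?thesis using assms is_path_rev[of ep V E vs es] internal_vertices_rev[of vs es]
    by (simp add: ear_candidate_def)
qed

text \<open>A closed path uses two edges at its first vertex, and any path uses two at an internal
  vertex. With degree 2 there is no room for the further edge \<open>f\<close>. Hence the path is
  open, and the far end of \<open>f\<close> is either new or the last vertex, in which case the
  extended path is closed.\<close>

lemma ear_candidate_extend:
  assumes wf: "wf_graph ep V E" and c: "ear_candidate ep V E e vs es"
    and f: "f \<in> E" "f \<notin> set es" "hd vs \<in> ep f" and deg: "degree ep E (hd vs) = 2"
  shows "\<exists>vs' es'. ear_candidate ep V E e vs' es' \<and> set es' = insert f (set es)"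
proof -
  have p: "is_path ep V E vs es" "e \<in> set es"
    and degi: "\<And>x. x \<in> internal_vertices vs es \<Longrightarrow> degree ep E x = 2"
    using c by (auto simp: ear_candidate_def)
  have len: "length vs = Suc (length es)" and ends: "\<forall>i<length es. ep (es ! i) = {vs ! i, vs ! Suc i}"
    and esE: "set es \<subseteq> E" and des: "distinct es" and vsV: "set vs \<subseteq> V"
    using p by (auto simp: is_path_def)
  have es0: "0 < length es" using p by auto
  have "vs \<noteq> []" using len by auto
  then have hd: "hd vs = vs ! 0" and last: "last vs = vs ! length es"
    using len by (simp_all add: hd_conv_nth last_conv_nth)
  obtain w where w: "ep f = {hd vs, w}" "w \<noteq> hd vs" "w \<in> V" using wf_edge_ends[OF wf f(1,3)] by metis
  have open_path: "distinct vs"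
  proof (rule ccontr)
    assume "\<not> distinct vs"
    then have cl: "vs ! 0 = vs ! length es" using p hd last by (auto simp: is_path_def)
    \<comment> \<open>One edge would be a loop. From length 2 on, the first and last edges are two
      different edges at \<open>hd vs\<close>.\<close>
    have "length es \<noteq> 1"
    proof
      assume l: "length es = 1"
      then have "ep (es ! 0) = {vs ! 0}" using ends cl by auto
      moreover have "es ! 0 \<in> E" using esE es0 by auto
      then have "card (ep (es ! 0)) = 2" using wf by (simp add: wf_graph_def)
      ultimately show False by simp
    qed
    then have "1 < length es" using es0 by linarith
    then have "es ! 0 \<noteq> es ! (length es - 1)"
      using nth_eq_iff_index_eq[OF des, of 0 "length es - 1"] by linarith
    moreover have "hd vs \<in> ep (es ! 0)" using ends es0 hd by auto
    moreover have "hd vs \<in> ep (es ! (length es - 1))" using ends es0 hd cl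
      by (metis Suc_diff_1 diff_less insertCI less_one)
    moreover have m: "es ! 0 \<in> set es" "es ! (length es - 1) \<in> set es" using es0 by auto
    ultimately have "f = es ! 0 \<or> f = es ! (length es - 1)"
      using degree_two_cases[OF deg, of "es ! 0" "es ! (length es - 1)" f] esE f by blast
    then show False using f m by auto
  qed
  have winner: "w \<notin> internal_vertices vs es"
  proof
    assume wi: "w \<in> internal_vertices vs es"
    then obtain i where i: "w = vs ! i" "0 < i" "i < length es" by (auto simp: internal_vertices_def)
    have "es ! (i - 1) \<noteq> es ! i" using nth_eq_iff_index_eq[OF des, of "i - 1" i] i by linarith
    moreover have "w \<in> ep (es ! i)" using ends i by auto
    moreover have "w \<in> ep (es ! (i - 1))" using ends i by auto
    moreover have m: "es ! (i - 1) \<in> set es" "es ! i \<in> set es" using i by auto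
    moreover have "w \<in> ep f" using w by simp
    ultimately have "f = es ! (i - 1) \<or> f = es ! i"
      using degree_two_cases[OF degi[OF wi], of "es ! (i - 1)" "es ! i" f] esE f by blast
    then show False using f m by auto
  qed
  have "distinct (w # vs) \<or> (hd (w # vs) = last (w # vs) \<and> distinct (tl (w # vs)))"
  proof (cases "w \<in> set vs")
    case True
    then obtain i where i: "i < length vs" "vs ! i = w" by (auto simp: in_set_conv_nth)
    have "i \<noteq> 0" using i w hd by metis
    then have "\<not> i < length es" using winner i by (auto simp: internal_vertices_def)
    then have "w = last vs" using i len last by (metis less_antisym)
    then show ?thesis using open_path len by auto
  qed (use open_path in simp)
  then have "is_path ep V E (w # vs) (f # es)"
    using len esE des vsV f w ends hd unfolding is_path_def by (auto simp: nth_Cons split: nat.split)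
  moreover have "internal_vertices (w # vs) (f # es) \<subseteq> insert (hd vs) (internal_vertices vs es)"
  proof
    fix x assume "x \<in> internal_vertices (w # vs) (f # es)"
    then obtain j where "x = vs ! j" "j < length es"
      unfolding internal_vertices_def by (auto simp: gr0_conv_Suc)
    then show "x \<in> insert (hd vs) (internal_vertices vs es)"
      using hd by (cases "j = 0") (auto simp: internal_vertices_def)
  qed
  ultimately have "ear_candidate ep V E e (w # vs) (f # es)"
    using p degi deg by (auto simp: ear_candidate_def)
  then show ?thesis by (intro exI[of _ "w # vs"] exI[of _ "f # es"]) simp
qed

text \<open>Follow a chain of adjacent edges to the first edge \<open>f\<close> that leaves the ear,
  at a vertex \<open>a\<close> of degree 2. If \<open>a\<close> is internal, the ear already uses
  both edges at \<open>a\<close>; if \<open>a\<close> is an end, the ear could be extended by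
  \<open>f\<close>.\<close>

lemma ear_class_in_ear:
  assumes wf: "wf_graph ep V E" and ear: "is_ear ep V E e vs es" and "(ear_adj ep E)\<^sup>*\<^sup>* e f"
  shows "f \<in> set es"
  using assms(3)
proof (induction rule: rtranclp_induct)
  case base
  then show ?case using ear by (simp add: is_ear_def ear_candidate_def)
next
  case (step g f)
  have c: "ear_candidate ep V E e vs es" using ear by (simp add: is_ear_def)
  have len: "length vs = Suc (length es)" and ends: "\<forall>i<length es. ep (es ! i) = {vs ! i, vs ! Suc i}"
    and esE: "set es \<subseteq> E" and des: "distinct es"
    using c by (auto simp: ear_candidate_def is_path_def)
  show ?case
  proof (rule ccontr)
    assume f: "f \<notin> set es"
    from step.hyps obtain a where a: "f \<in> E" "a \<in> ep g" "a \<in> ep f" "degree ep E a = 2"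
      by (auto simp: ear_adj_def)
    have maximal: "set es' = set es" if "ear_candidate ep V E e vs' es'" "set es \<subseteq> set es'" for vs' es'
      using ear that by (auto simp: is_ear_def)
    obtain i where i: "i < length es" "es ! i = g" using step.IH by (auto simp: in_set_conv_nth)
    then have "a = vs ! i \<or> a = vs ! Suc i" using ends a by auto
    then obtain k where k: "k \<le> length es" "a = vs ! k" using i by (metis Suc_leI less_imp_le)
    consider "k = 0" | "k = length es" | "0 < k" "k < length es" using k by linarith
    then show False
    proof cases
      case 1
      then have "a = hd vs" using k len by (metis hd_conv_nth length_0_conv nat.simps(3))
      then obtain vs' es' where "ear_candidate ep V E e vs' es'" "set es' = insert f (set es)"
        using ear_candidate_extend[OF wf c, of f] a f by auto
      then show False using maximal f by blast
    next
      case 2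
      then have "a = hd (rev vs)" using k len
        by (metis diff_Suc_1 hd_rev last_conv_nth length_0_conv nat.simps(3))
      then obtain vs' es' where "ear_candidate ep V E e vs' es'" "set es' = insert f (set es)"
        using ear_candidate_extend[OF wf ear_candidate_rev[OF c], of f] a f by auto
      then show False using maximal f by blast
    next
      case 3
      have "es ! (k - 1) \<noteq> es ! k" using nth_eq_iff_index_eq[OF des, of "k - 1" k] 3 by linarith
      moreover have "a \<in> ep (es ! k)" "a \<in> ep (es ! (k - 1))" using ends 3 k by auto
      moreover have m: "es ! (k - 1) \<in> set es" "es ! k \<in> set es" using 3 by auto
      ultimately have "f = es ! (k - 1) \<or> f = es ! k"
        using degree_two_cases[OF a(4), of "es ! (k - 1)" "es ! k" f] esE a by blast
      then show False using f m by auto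
    qed
  qed
qed

text \<open>The edge sets of candidates form a finite nonempty family, since the edge alone is a
  candidate; an inclusion-maximal member gives an ear.\<close>

lemma ear_exists:
  assumes wf: "wf_graph ep V E" and e: "e \<in> E"
  shows "\<exists>vs es. is_ear ep V E e vs es"
proof -
  have "card (ep e) = 2" "ep e \<subseteq> V" using wf e by (auto simp: wf_graph_def)
  then obtain p q where pq: "ep e = {p, q}" "p \<noteq> q" "p \<in> V" "q \<in> V" by (auto simp: card_2_iff)
  define C where "C = {X. \<exists>vs es. ear_candidate ep V E e vs es \<and> X = set es}"
  have "ear_candidate ep V E e [p, q] [e]"
    using e pq by (auto simp: ear_candidate_def is_path_def internal_vertices_def)
  then have ne: "C \<noteq> {}" unfolding C_def by blast
  have "C \<subseteq> Pow E" by (auto simp: C_def ear_candidate_def is_path_def)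
  then have fin: "finite C" using wf by (meson finite_Pow_iff finite_subset wf_graph_def)
  obtain X where X: "X \<in> C" "\<forall>Y\<in>C. X \<subseteq> Y \<longrightarrow> X = Y"
    using finite_has_maximal[OF fin ne] by metis
  then obtain vs es where "ear_candidate ep V E e vs es" "X = set es" unfolding C_def by blast
  moreover have "set es' = X" if "ear_candidate ep V E e vs' es'" "X \<subseteq> set es'" for vs' es'
    using X(2) that unfolding C_def by blast
  ultimately have "is_ear ep V E e vs es" unfolding is_ear_def by blast
  then show ?thesis by blast
qed

text \<open>\<open>ear_labels\<close> ranges over all paths that qualify as an ear. They have the
  same edges, namely the class of \<open>e\<close>.\<close>

lemma ear_labels_eq:
  assumes "wf_graph ep (fst H) (snd H)" "e \<in> snd H"
  shows "ear_labels ep H e = {m. \<exists>b. (ear_adj ep (snd H))\<^sup>*\<^sup>* e (Virt m b)}"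
proof -
  obtain vs es where ear: "is_ear ep (fst H) (snd H) e vs es" using ear_exists[OF assms] by blast
  have "(ear_adj ep (snd H))\<^sup>*\<^sup>* e f" if "is_ear ep (fst H) (snd H) e vs' es'" "f \<in> set es'" for vs' es' f
    using ear_edges_in_class that unfolding is_ear_def by metis
  then show ?thesis unfolding ear_labels_def
    using ear ear_class_in_ear[OF assms(1) ear] by blast
qed

section \<open>States reachable by splits\<close>

text \<open>Common feature of split components that is also inherited by lossless merges.
  Connectivity is left out of the first alternative and is supplied by biconnectedness when a
  \<open>polygon\<close> is concluded; the bound on \<open>card V\<close> excludes a pair of
  parallel edges.\<close>

definition cycle_or_min_degree_3 :: "('x \<Rightarrow> 'v set) \<Rightarrow> 'v set \<Rightarrow> 'x set \<Rightarrow> bool" where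
  "cycle_or_min_degree_3 ep V E \<longleftrightarrow>
     (3 \<le> card V \<and> (\<forall>x\<in>V. degree ep E x = 2)) \<or> (\<forall>x\<in>V. 3 \<le> degree ep E x)"

text \<open>A third vertex would be cut off from \<open>a\<close> by deleting \<open>b\<close>. So
  there are only two vertices, and every edge is at \<open>a\<close>.\<close>

lemma biconnected_degree_neighbours:
  assumes wf: "wf_graph ep V E" and bic: "biconnected ep V E" and c3: "3 \<le> card E"
    and a: "a \<in> V" and b: "b \<in> V" "b \<noteq> a"
    and only: "\<And>f. f \<in> E \<Longrightarrow> a \<in> ep f \<Longrightarrow> ep f = {a, b}"
  shows "3 \<le> degree ep E a"
proof -
  have "V = {a, b}"
  proof (rule ccontr)
    assume "V \<noteq> {a, b}"
    then obtain z where z: "z \<in> V" "z \<noteq> a" "z \<noteq> b" using a b by blast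
    have "(step ep (V - {b}) E)\<^sup>*\<^sup>* a z"
      using bic a b z by (auto simp: biconnected_iff connected_graph_iff_steps)
    then obtain y where "step ep (V - {b}) E a y" using z(2) by (metis converse_rtranclpE)
    then obtain f where "f \<in> E" "ep f = {a, y}" "y \<noteq> b" "y \<in> V" unfolding step_def by blast
    then have "{a, y} = {a, b}" using only by simp
    then show False using b \<open>y \<noteq> b\<close> by (auto simp: doubleton_eq_iff)
  qed
  then have "a \<in> ep f" if f: "f \<in> E" for f
  proof -
    have "card (ep f) = 2" "ep f \<subseteq> {a, b}" using wf f \<open>V = {a, b}\<close> by (auto simp: wf_graph_def)
    then have "ep f = {a, b}" using b by (intro card_subset_eq) auto
    then show ?thesis by simp
  qed
  then have "{f \<in> E. a \<in> ep f} = E" by auto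
  then show ?thesis using c3 by (simp add: degree_def)
qed

text \<open>A vertex \<open>a\<close> of degree below 3 has exactly two edges, leading to different
  neighbours \<open>b\<close> and \<open>c\<close>. These two edges could be split off at
  \<open>{b, c}\<close> unless only one other edge exists, and then the graph is a triangle.\<close>

lemma unsplittable_cycle_or_min_degree_3:
  assumes wf: "wf_graph ep V E" and bic: "biconnected ep V E" and c3: "3 \<le> card E"
    and nosep: "\<And>u v F. \<not> sep_union ep V E u v F"
  shows "cycle_or_min_degree_3 ep V E"
proof (cases "\<forall>x\<in>V. 3 \<le> degree ep E x")
  case False
  then obtain a where a: "a \<in> V" "degree ep E a < 3" by auto
  have finE: "finite E" using wf by (simp add: wf_graph_def)
  obtain f0 where f0: "f0 \<in> E" using c3 by fastforce
  have cf0: "card (ep f0) = 2" "ep f0 \<subseteq> V" using wf f0 by (auto simp: wf_graph_def)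
  have "\<not> ep f0 \<subseteq> {a}" using card_mono[of "{a}" "ep f0"] cf0 by auto
  then obtain z where z: "z \<in> V" "z \<noteq> a" using cf0 by blast
  have "(step ep V E)\<^sup>*\<^sup>* a z" using bic a z by (auto simp: biconnected_iff connected_graph_iff_steps)
  then obtain b where "step ep V E a b" using z(2) by (metis converse_rtranclpE)
  then obtain e where e: "e \<in> E" "ep e = {a, b}" "b \<in> V" unfolding step_def by blast
  have "card (ep e) = 2" using wf e(1) by (simp add: wf_graph_def)
  then have ba: "b \<noteq> a" using e by auto
  obtain f where f: "f \<in> E" "a \<in> ep f" "ep f \<noteq> {a, b}"
    using biconnected_degree_neighbours[OF wf bic c3 a(1) e(3) ba] a(2) by force
  obtain c where c: "ep f = {a, c}" "c \<noteq> a" "c \<in> V" using wf_edge_ends[OF wf f(1,2)] by metis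
  have bc: "b \<noteq> c" using c f by blast
  have ef: "e \<noteq> f" using e f by blast
  have fin: "finite {h \<in> E. a \<in> ep h}" using finE by simp
  have sub: "{e, f} \<subseteq> {h \<in> E. a \<in> ep h}" using e f by auto
  have "card {e, f} = 2" using ef by simp
  then have "card {e, f} = card {h \<in> E. a \<in> ep h}"
    using card_mono[OF fin sub] a(2) unfolding degree_def by linarith
  then have at_a: "{h \<in> E. a \<in> ep h} = {e, f}" using card_subset_eq[OF fin sub] by simp
  have "card (E - {e, f}) = card E - 2" using ef e f finE by (simp add: card_Diff_subset)
  moreover have "\<not> 2 \<le> card (E - {e, f})"
  proof
    assume "2 \<le> card (E - {e, f})"
    then have "sep_union ep V E b c {e, f}"
      unfolding sep_union_iff[OF wf] using bc e c f ef at_a by auto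
    then show False using nosep by blast
  qed
  ultimately have cE: "card E = 3" and "card (E - {e, f}) = 1" using c3 by linarith+
  then obtain g where g: "E - {e, f} = {g}" using card_1_singletonE by blast
  have E: "E = {e, f, g}" using g e(1) f(1) by blast
  have gne: "g \<noteq> e" "g \<noteq> f" using g by blast+
  have conn: "connected_graph ep (V - {a}) E" using bic a by (simp add: biconnected_iff)
  have inV: "b \<in> V - {a}" "c \<in> V - {a}" using e c ba by auto
  \<comment> \<open>Without \<open>a\<close> only \<open>g\<close> is left to connect the remaining
    vertices, so each of them is an end of \<open>g\<close>.\<close>
  have key: "x \<in> ep g" if xy: "x \<in> V - {a}" "y \<in> V - {a}" "y \<noteq> x" for x y
  proof -
    have "(step ep (V - {a}) E)\<^sup>*\<^sup>* x y" using conn that by (auto simp: connected_graph_iff_steps)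
    then obtain w where "step ep (V - {a}) E x w" using xy(3) by (metis converse_rtranclpE)
    then obtain h where h: "h \<in> E" "ep h = {x, w}" "x \<noteq> a" "w \<noteq> a" unfolding step_def by blast
    then have "a \<notin> ep h" by simp
    then have "h \<noteq> e" "h \<noteq> f" using e(2) c(1) by auto
    then have "h = g" using E h(1) by simp
    then show ?thesis using h(2) by simp
  qed
  have cg: "card (ep g) = 2" using wf E by (auto simp: wf_graph_def)
  have bcg: "b \<in> ep g" "c \<in> ep g" using key[of b c] key[of c b] inV bc by blast+
  have "finite (ep g)" using cg by (metis card.infinite zero_neq_numeral)
  then have epg: "ep g = {b, c}" using bcg cg bc card_subset_eq[of "ep g" "{b, c}"] by simp
  have "V = {a, b, c}"
  proof
    show "V \<subseteq> {a, b, c}"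
    proof
      fix x assume "x \<in> V"
      then show "x \<in> {a, b, c}" using key[of x b] inV epg by (cases "x = b"; cases "x = a") auto
    qed
  qed (use a e c in auto)
  moreover have "degree ep E a = 2" using at_a ef by (simp add: degree_def)
  moreover have "{h \<in> E. b \<in> ep h} = {e, g}" "{h \<in> E. c \<in> ep h} = {f, g}"
    using E e(2) c(1) epg ba bc c(2) by auto
  then have "degree ep E b = 2" "degree ep E c = 2" using gne by (simp_all add: degree_def)
  ultimately show ?thesis using ba bc c(2) by (auto simp: cycle_or_min_degree_3_def)
qed (simp add: cycle_or_min_degree_3_def)

text \<open>The part of the invariant that merges are shown to keep; \<open>split_state\<close> adds
  what is followed along splits. The endpoint condition concerns all labels: those not yet used have
  the same default value for both copies.\<close>

definition wf_state :: "('v, 'e) state \<Rightarrow> bool" where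
  "wf_state st \<longleftrightarrow> finite (fst st) \<and>
     (\<forall>H\<in>fst st. wf_graph (snd st) (fst H) (snd H)) \<and>
     (\<forall>H\<in>fst st. \<forall>K\<in>fst st. H \<noteq> K \<longrightarrow> snd H \<inter> snd K = {}) \<and>
     (\<forall>n. snd st (Virt n True) = snd st (Virt n False))"

definition split_state :: "('v, 'e) state \<Rightarrow> bool" where
  "split_state st \<longleftrightarrow> wf_state st \<and>
     (\<forall>H\<in>fst st. biconnected (snd st) (fst H) (snd H) \<and> 3 \<le> card (snd H) \<and>
        (\<forall>n. \<not> (Virt n True \<in> snd H \<and> Virt n False \<in> snd H)))"

definition weight :: "('v, 'e) state \<Rightarrow> int" where
  "weight st = (\<Sum>H\<in>fst st. int (card (fst H)) - 2)"

lemma wf_graph_cong: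
  assumes "\<And>f. f \<in> E \<Longrightarrow> ep' f = ep f"
  shows "wf_graph ep' V E = wf_graph ep V E"
  using assms by (auto simp: wf_graph_def)

lemma sep_union_cong:
  assumes "\<And>f. f \<in> E \<Longrightarrow> ep' f = ep f" and wf: "wf_graph ep V E"
  shows "sep_union ep' V E u v F = sep_union ep V E u v F"
proof -
  have wf': "wf_graph ep' V E" using wf wf_graph_cong[of E ep' ep, OF assms(1)] by simp
  have "(\<forall>e\<in>F. \<forall>f\<in>E. \<forall>x. x \<in> ep' e \<and> x \<in> ep' f \<and> x \<noteq> u \<and> x \<noteq> v \<longrightarrow> f \<in> F) \<longleftrightarrow>
    (\<forall>e\<in>F. \<forall>f\<in>E. \<forall>x. x \<in> ep e \<and> x \<in> ep f \<and> x \<noteq> u \<and> x \<noteq> v \<longrightarrow> f \<in> F)" if FE: "F \<subseteq> E"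
    by (intro ball_cong refl all_cong1) (use assms(1) FE in auto)
  then show ?thesis unfolding sep_union_iff[OF wf] sep_union_iff[OF wf'] by argo
qed

locale split_step =
  fixes st :: "('v, 'e) state" and H u v E' n
  assumes state: "split_state st" and ok: "split_ok st H u v E' n"
begin

abbreviation "ep' \<equiv> split_ep st u v n"
abbreviation "P1 \<equiv> piece1 st H u v E' n"
abbreviation "P2 \<equiv> piece2 st H u v E' n"
abbreviation "st' \<equiv> split_res st H u v E' n"

lemma HS: "H \<in> fst st" using ok by (simp add: split_ok_def)

lemma fresh: "K \<in> fst st \<Longrightarrow> Virt n b \<notin> snd K"
  using ok by (auto simp: split_ok_def labels_def)

lemma ep'_old: "K \<in> fst st \<Longrightarrow> f \<in> snd K \<Longrightarrow> ep' f = snd st f"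
  using fresh[of K] by (auto simp: split_ep_def)

lemma ep'_new: "ep' (Virt n b) = {u, v}"
  by (cases b) (auto simp: split_ep_def)

lemma wf_H: "wf_graph (snd st) (fst H) (snd H)"
  using state HS by (simp add: split_state_def wf_state_def)

lemma separation_old: "separation (snd st) (fst H) (snd H) u v E'"
  using ok wf_H by (simp add: separation_def split_ok_def)

lemma separation_new: "separation ep' (fst H) (snd H) u v E'"
  using separation_old
    wf_graph_cong[of "snd H" ep' "snd st", OF ep'_old[OF HS]]
    biconnected_cong[of "snd H" ep' "snd st", OF ep'_old[OF HS]]
    sep_union_cong[of "snd H" ep' "snd st", OF ep'_old[OF HS] wf_H]
  by (simp add: separation_def)

text \<open>Both sides are closed up under the updated map \<open>ep'\<close>: the side
  \<open>E'\<close> receives the copy \<open>True\<close>, its complement the copy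
  \<open>False\<close>.\<close>

sublocale A: split_piece ep' "fst H" "snd H" u v E' "Virt n True"
  using separation_new fresh[OF HS] ep'_new
  by (simp add: split_piece_def split_piece_axioms_def)

sublocale B: split_piece ep' "fst H" "snd H" u v "snd H - E'" "Virt n False"
  using separation.compl[OF separation_new] fresh[OF HS] ep'_new
  by (simp add: split_piece_def split_piece_axioms_def)

lemma piece1_eq: "P1 = (\<Union> (ep' ` E') \<union> {u, v}, insert (Virt n True) E')"
proof -
  have "snd st ` E' = ep' ` E'" using ep'_old[OF HS] A.FE by (intro image_cong) auto
  then show ?thesis by (simp add: piece1_def)
qed

lemma piece2_eq: "P2 = (\<Union> (ep' ` (snd H - E')) \<union> {u, v}, insert (Virt n False) (snd H - E'))"
proof -
  have "snd st ` (snd H - E') = ep' ` (snd H - E')" using ep'_old[OF HS] by (intro image_cong) auto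
  then show ?thesis by (simp add: piece2_def)
qed

lemma snd_pieces [simp]:
  "snd P1 = insert (Virt n True) E'" "snd P2 = insert (Virt n False) (snd H - E')"
  by (simp_all add: piece1_def piece2_def)

lemma snd_st' [simp]: "snd st' = ep'" by (simp add: split_res_def)

lemma fst_st': "fst st' = (fst st - {H}) \<union> {P1, P2}" by (simp add: split_res_def)

lemma in_st':
  "K \<in> fst st \<Longrightarrow> K \<noteq> H \<Longrightarrow> K \<in> fst st'" "P1 \<in> fst st'" "P2 \<in> fst st'"
  by (simp_all add: fst_st')

lemma st'_cases:
  assumes "K \<in> fst st'"
  obtains "K \<in> fst st" "K \<noteq> H" | "K = P1" | "K = P2"
  using assms unfolding fst_st' by blast

lemma pieces_new: "P1 \<notin> fst st" "P2 \<notin> fst st" "P1 \<noteq> P2"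
proof -
  show "P1 \<notin> fst st" using fresh[of P1 True] by auto
  show "P2 \<notin> fst st" using fresh[of P2 False] by auto
  have "Virt n True \<in> snd P1" "Virt n True \<notin> snd P2" using fresh[OF HS] by auto
  then show "P1 \<noteq> P2" by metis
qed

lemma split_state_st': "split_state st'"
proof -
  have wfs: "finite (fst st)" "\<And>K. K \<in> fst st \<Longrightarrow> wf_graph (snd st) (fst K) (snd K)"
    and disj: "\<And>K L. K \<in> fst st \<Longrightarrow> L \<in> fst st \<Longrightarrow> K \<noteq> L \<Longrightarrow> snd K \<inter> snd L = {}"
    and twin: "\<And>m. snd st (Virt m True) = snd st (Virt m False)"
    and bic: "\<And>K. K \<in> fst st \<Longrightarrow> biconnected (snd st) (fst K) (snd K) \<and> 3 \<le> card (snd K) \<and>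
        (\<forall>n. \<not> (Virt n True \<in> snd K \<and> Virt n False \<in> snd K))"
    using state by (auto simp: split_state_def wf_state_def)
  have wf1: "wf_graph ep' (fst K) (snd K)" "biconnected ep' (fst K) (snd K)" "3 \<le> card (snd K)"
      "\<not> (Virt m True \<in> snd K \<and> Virt m False \<in> snd K)" if K: "K \<in> fst st'" for K m
  proof -
    have "wf_graph ep' (fst K) (snd K) \<and> biconnected ep' (fst K) (snd K) \<and> 3 \<le> card (snd K) \<and>
      \<not> (Virt m True \<in> snd K \<and> Virt m False \<in> snd K)"
    proof -
      consider "K \<in> fst st" | "K = P1" | "K = P2" using K fst_st' by blast
      then show ?thesis
      proof cases
        case 1
        then show ?thesis
          using wfs(2)[OF 1] bic[OF 1] wf_graph_cong[of "snd K" ep' "snd st", OF ep'_old[OF 1]]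
            biconnected_cong[of "snd K" ep' "snd st", OF ep'_old[OF 1]] by simp
      next
        case 2
        have "\<not> (Virt m True \<in> snd P1 \<and> Virt m False \<in> snd P1)"
          using bic[OF HS] fresh[OF HS] A.FE by auto
        then show ?thesis unfolding 2
          using A.wf_piece A.biconnected_piece A.card_piece by (simp add: piece1_eq)
      next
        case 3
        have "\<not> (Virt m True \<in> snd P2 \<and> Virt m False \<in> snd P2)"
          using bic[OF HS] fresh[OF HS] by auto
        then show ?thesis unfolding 3
          using B.wf_piece B.biconnected_piece B.card_piece by (simp add: piece2_eq)
      qed
    qed
    then show "wf_graph ep' (fst K) (snd K)" "biconnected ep' (fst K) (snd K)" "3 \<le> card (snd K)"
      "\<not> (Virt m True \<in> snd K \<and> Virt m False \<in> snd K)" by blast+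
  qed
  have dis1: "snd K \<inter> snd P1 = {}" "snd K \<inter> snd P2 = {}" if "K \<in> fst st - {H}" for K
    using that disj[of K H] HS fresh[of K] A.FE by auto
  have dis2: "snd P1 \<inter> snd P2 = {}" using fresh[OF HS] A.FE by auto
  have "snd K \<inter> snd L = {}" if KL: "K \<in> fst st'" "L \<in> fst st'" "K \<noteq> L" for K L
  proof -
    have K: "K \<in> fst st - {H} \<or> K = P1 \<or> K = P2" and L: "L \<in> fst st - {H} \<or> L = P1 \<or> L = P2"
      using KL unfolding fst_st' by blast+
    show ?thesis
    proof (cases "K \<in> fst st - {H} \<and> L \<in> fst st - {H}")
      case True
      then show ?thesis using disj KL(3) by blast
    next
      case False
      then show ?thesis using K L KL(3) dis1[of K] dis1[of L] dis2 by (metis Int_commute)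
    qed
  qed
  moreover have "ep' (Virt m True) = ep' (Virt m False)" for m
    using twin by (auto simp: split_ep_def)
  moreover have "finite (fst st')" using wfs(1) by (simp add: fst_st')
  ultimately show ?thesis using wf1 by (simp add: split_state_def wf_state_def)
qed

lemma weight_st': "weight st' = weight st"
proof -
  let ?w = "\<lambda>K :: ('v, 'e) gr. int (card (fst K)) - 2"
  have fin: "finite (fst st)" using state by (simp add: split_state_def wf_state_def)
  have "weight st' = sum ?w (fst st - {H}) + (?w P1 + ?w P2)"
    unfolding weight_def fst_st' using fin pieces_new
    by (subst sum.union_disjoint) auto
  also have "?w P1 + ?w P2 = ?w H"
    using A.card_verts unfolding piece1_eq piece2_eq by simp
  also have "sum ?w (fst st - {H}) + ?w H = weight st"
    unfolding weight_def using sum.remove[OF fin HS, of ?w] by simp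
  finally show ?thesis .
qed

lemma labels_st': "labels (fst st') = insert n (labels (fst st))"
proof -
  have *: "Virt m b \<in> snd P1 \<or> Virt m b \<in> snd P2 \<longleftrightarrow> m = n \<or> Virt m b \<in> snd H" for m b
    unfolding snd_pieces using A.FE by (cases b) blast+
  show ?thesis
  proof (rule set_eqI)
    fix m
    have "m \<in> labels (fst st') \<longleftrightarrow>
        (\<exists>K\<in>fst st - {H}. \<exists>b. Virt m b \<in> snd K) \<or> (\<exists>b. Virt m b \<in> snd P1 \<or> Virt m b \<in> snd P2)"
      unfolding labels_def fst_st' by blast
    also have "\<dots> \<longleftrightarrow> m = n \<or> (\<exists>K\<in>fst st - {H}. \<exists>b. Virt m b \<in> snd K) \<or> (\<exists>b. Virt m b \<in> snd H)"
      unfolding * by blast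
    also have "\<dots> \<longleftrightarrow> m \<in> insert n (labels (fst st))"
      unfolding labels_def using HS by blast
    finally show "m \<in> labels (fst st') \<longleftrightarrow> m \<in> insert n (labels (fst st))" .
  qed
qed

lemma low_degree_step:
  assumes K: "K \<in> fst st" "g \<in> snd K" "a \<in> snd st g" "degree (snd st) (snd K) a \<le> d"
  shows "\<exists>L\<in>fst st'. g \<in> snd L \<and> a \<in> ep' g \<and> degree ep' (snd L) a \<le> d"
proof -
  have a: "a \<in> ep' g" using K(3) unfolding ep'_old[OF K(1,2)] .
  have deg: "degree ep' (snd K) a \<le> d"
    using K(4) degree_cong[of "snd K" ep' "snd st", OF ep'_old[OF K(1)]] by simp
  show ?thesis
  proof (cases "K = H")
    case False
    then show ?thesis using K(2) a deg in_st'(1)[OF K(1)] by blast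
  next
    case True
    show ?thesis
    proof (cases "g \<in> E'")
      case True
      then have "g \<in> snd P1" by simp
      moreover have "degree ep' (snd P1) a \<le> d"
        using A.degree_piece_le[of a] deg \<open>K = H\<close> by simp
      ultimately show ?thesis using a in_st'(2) by blast
    next
      case False
      then have "g \<in> snd P2" using K(2) \<open>K = H\<close> by simp
      moreover have "degree ep' (snd P2) a \<le> d"
        using B.degree_piece_le[of a] deg \<open>K = H\<close> by simp
      ultimately show ?thesis using a in_st'(3) by blast
    qed
  qed
qed

end

lemma run_split_state:
  assumes "run st col ss st'' col''" "split_state st"
  shows "split_state st'' \<and> weight st'' = weight st"
  using assms
proof (induction rule: run.induct)
  case (run_Cons st H u v E' n col ss st'' col'')
  interpret split_step st H u v E' n
    using run_Cons.hyps(1) run_Cons.prems(1) by (rule split_step.intro[rotated])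
  show ?case using run_Cons.IH[OF split_state_st'] weight_st' by simp
qed simp

lemma split_rel_split_state:
  assumes "split_rel\<^sup>*\<^sup>* st st''" "split_state st"
  shows "split_state st'' \<and> weight st'' = weight st"
  using assms
proof (induction rule: rtranclp_induct)
  case (step y z)
  then obtain H u v E' n where "split_ok y H u v E' n" and z: "z = split_res y H u v E' n"
    by (auto simp: split_rel_def)
  moreover have y: "split_state y" "weight y = weight st" using step by auto
  ultimately interpret split_step y H u v E' n by (simp add: split_step_def)
  show ?case using y split_state_st' weight_st' z by simp
qed simp

definition low_edge :: "('v, 'e) state \<Rightarrow> 'e edg \<Rightarrow> bool" where
  "low_edge st g \<longleftrightarrow> (\<exists>K\<in>fst st. g \<in> snd K \<and> (\<exists>a\<in>snd st g. degree (snd st) (snd K) a \<le> 2))"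

definition twin_free :: "('v, 'e) state \<Rightarrow> bool" where
  "twin_free st \<longleftrightarrow> (\<forall>n. \<not> (low_edge st (Virt n True) \<and> low_edge st (Virt n False)))"

lemma (in split_step) low_edge_step: "low_edge st g \<Longrightarrow> low_edge st' g"
  unfolding low_edge_def snd_st' using low_degree_step by meson

lemma run_low_edge:
  assumes "run st col ss F c" "split_state st" "low_edge st g"
  shows "low_edge F g"
  using assms
proof (induction rule: run.induct)
  case (run_Cons st H u v E' n col ss st'' col'')
  interpret split_step st H u v E' n
    using run_Cons.hyps(1) run_Cons.prems(1) by (rule split_step.intro[rotated])
  show ?case using run_Cons.IH[OF split_state_st'] low_edge_step run_Cons.prems(2) by blast
qed

text \<open>The property travels backwards: two low copies would stay low until the end of the
  run.\<close>

lemma run_twin_free: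
  assumes "run st col ss F c" "split_state st" "twin_free F"
  shows "twin_free st"
  using assms run_low_edge unfolding twin_free_def by metis

section \<open>The colouring invariant\<close>

text \<open>The closure is reflexive, so original edges count as green, in agreement with
  \<open>green_or_orig\<close>.\<close>

definition ear_green :: "('e edg \<Rightarrow> 'v set) \<Rightarrow> 'e edg set \<Rightarrow> 'e edg \<Rightarrow> bool" where
  "ear_green ep E x \<longleftrightarrow> (\<exists>f. (ear_adj ep E)\<^sup>*\<^sup>* x (Orig f))"

definition green_label :: "('v, 'e) state \<Rightarrow> nat \<Rightarrow> bool" where
  "green_label st n \<longleftrightarrow>
     (\<exists>K\<in>fst st. \<exists>b. Virt n b \<in> snd K \<and> ear_green (snd st) (snd K) (Virt n b))"

definition ear_coloured :: "('v, 'e) state \<Rightarrow> colouring \<Rightarrow> bool" where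
  "ear_coloured st col \<longleftrightarrow>
     (\<forall>n\<in>labels (fst st). col n = Some (if green_label st n then Green else Red))"

lemma ear_green_class: "(ear_adj ep E)\<^sup>*\<^sup>* x y \<Longrightarrow> ear_green ep E y \<Longrightarrow> ear_green ep E x"
  unfolding ear_green_def by (meson rtranclp_trans)

text \<open>A virtual edge is not original, so the chain has a first step, and this step is taken at
  an end of degree 2.\<close>

lemma ear_green_virt_low:
  assumes "ear_green ep E (Virt m b)"
  shows "\<exists>a\<in>ep (Virt m b). degree ep E a = 2"
proof -
  obtain f where "(ear_adj ep E)\<^sup>*\<^sup>* (Virt m b) (Orig f)" using assms by (auto simp: ear_green_def)
  then obtain y where "ear_adj ep E (Virt m b) y" by (metis converse_rtranclpE edg.distinct(1))
  then show ?thesis by (auto simp: ear_adj_def)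
qed

lemma green_label_in_labels: "green_label st n \<Longrightarrow> n \<in> labels (fst st)"
  by (auto simp: green_label_def labels_def)

context split_step
begin

definition nbr :: "'e edg \<Rightarrow> bool" where
  "nbr e \<longleftrightarrow> (ear_adj ep' (snd P1) (Virt n True) e \<and> e \<noteq> Virt n True) \<or>
     (ear_adj ep' (snd P2) (Virt n False) e \<and> e \<noteq> Virt n False)"

abbreviation "green_H \<equiv> ear_green ep' (snd H)"

lemma ear_green_old:
  assumes "K \<in> fst st"
  shows "ear_green ep' (snd K) = ear_green (snd st) (snd K)"
  using ear_adj_cong[of "snd K" ep' "snd st", OF ep'_old[OF assms]]
  by (intro ext) (simp add: ear_green_def)

lemma is_25split_iff_nbr:
  "(\<exists>c a. is_25split (snd st) (fst H) (snd H) c e a u v E') \<longleftrightarrow> nbr e"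
proof -
  have sets: "{f\<in>E'. a \<in> snd st f} = {f\<in>E'. a \<in> ep' f}"
    "{f\<in>snd H - E'. a \<in> snd st f} = {f\<in>snd H - E'. a \<in> ep' f}" for a
    using ep'_old[OF HS] A.FE by auto
  show ?thesis
    unfolding separation.is_25split_iff[OF separation_old] sets nbr_def snd_pieces
      A.ear_adj_new_iff B.ear_adj_new_iff by blast
qed

lemma nbr_old: "nbr e \<Longrightarrow> e \<in> snd H"
  unfolding nbr_def using A.FE by (auto simp: ear_adj_def)

lemma low_edge_if_ear_adj:
  "K \<in> fst st' \<Longrightarrow> ear_adj ep' (snd K) e f \<Longrightarrow> low_edge st' e"
  "K \<in> fst st' \<Longrightarrow> ear_adj ep' (snd K) e f \<Longrightarrow> low_edge st' f"
  unfolding low_edge_def snd_st' ear_adj_def by (metis order_refl)+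

lemma nbr_low: "nbr e \<Longrightarrow> low_edge st' e"
  using low_edge_if_ear_adj(2) in_st'(2,3) unfolding nbr_def by blast

text \<open>If neither \<open>u\<close> nor \<open>v\<close> has degree 2, no ear of
  \<open>H\<close> crosses between the sides, and each survives within an ear of one piece.\<close>

lemma green_label_mono_if:
  assumes deg: "\<And>a. a \<in> {u, v} \<Longrightarrow> degree ep' (snd H) a \<noteq> 2" and "green_label st m"
  shows "green_label st' m"
proof -
  obtain K b where K: "K \<in> fst st" "Virt m b \<in> snd K" "ear_green ep' (snd K) (Virt m b)"
    using assms(2) ear_green_old unfolding green_label_def by metis
  show ?thesis
  proof (cases "K = H")
    case False
    then show ?thesis using K in_st'(1)[OF K(1)] unfolding green_label_def snd_st' by blast
  next
    case True
    then obtain f where f: "(ear_adj ep' (snd H))\<^sup>*\<^sup>* (Virt m b) (Orig f)"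
      using K(3) by (auto simp: ear_green_def)
    show ?thesis
    proof (cases "Virt m b \<in> E'")
      case True
      then have "ear_green ep' (snd P1) (Virt m b)" "Virt m b \<in> snd P1"
        using A.ear_class_old_piece[OF f True deg] by (auto simp: ear_green_def)
      then show ?thesis using in_st'(2) unfolding green_label_def snd_st' by blast
    next
      case False
      then have "Virt m b \<in> snd H - E'" using K \<open>K = H\<close> by simp
      then have "ear_green ep' (snd P2) (Virt m b)" "Virt m b \<in> snd P2"
        using B.ear_class_old_piece[OF f _ deg] by (auto simp: ear_green_def)
      then show ?thesis using in_st'(3) unfolding green_label_def snd_st' by blast
    qed
  qed
qed

lemma green_label_cases:
  assumes "green_label st' m"
  obtains "green_label st m"
  | b where "Virt m b \<in> snd P1" "ear_green ep' (snd P1) (Virt m b)"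
  | b where "Virt m b \<in> snd P2" "ear_green ep' (snd P2) (Virt m b)"
proof -
  obtain K b where K: "K \<in> fst st'" "Virt m b \<in> snd K" "ear_green ep' (snd K) (Virt m b)"
    using assms unfolding green_label_def snd_st' by blast
  from K(1) show thesis
  proof (cases rule: st'_cases)
    case 1
    then have "green_label st m" using K ear_green_old[OF 1(1)] unfolding green_label_def by metis
    then show thesis by (rule that(1))
  next
    case 2
    then show thesis using K that(2) by blast
  next
    case 3
    then show thesis using K that(3) by blast
  qed
qed

lemma green_label_if_green_H: "Virt m b \<in> snd H \<Longrightarrow> green_H (Virt m b) \<Longrightarrow> green_label st m"
  using HS ear_green_old[OF HS] unfolding green_label_def by metis

text \<open>A chain from a virtual to an original edge in a piece either lies in \<open>H\<close>
  already or continues from a neighbour of the new edge along an ear of \<open>H\<close>. The latter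
  would make that neighbour green.\<close>

lemma green_label_stable:
  assumes "\<And>e. nbr e \<Longrightarrow> \<not> green_H e" "green_label st' m"
  shows "green_label st m"
  using assms(2)
proof (cases rule: green_label_cases)
  case (2 b)
  then obtain f where f: "(ear_adj ep' (snd P1))\<^sup>*\<^sup>* (Virt m b) (Orig f)" by (auto simp: ear_green_def)
  have "\<not> (\<exists>e. ear_adj ep' (snd P1) (Virt n True) e \<and> e \<noteq> Virt n True \<and>
      (ear_adj ep' (snd H))\<^sup>*\<^sup>* e (Orig f))"
    using assms(1) unfolding nbr_def ear_green_def by blast
  then have "Virt m b \<noteq> Virt n True" "(ear_adj ep' (snd H))\<^sup>*\<^sup>* (Virt m b) (Orig f)"
    using A.ear_class_piece_old[OF f[unfolded snd_pieces] 2(1)[unfolded snd_pieces]] by auto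
  then show ?thesis using 2(1) A.FE green_label_if_green_H[of m b] by (auto simp: ear_green_def)
next
  case (3 b)
  then obtain f where f: "(ear_adj ep' (snd P2))\<^sup>*\<^sup>* (Virt m b) (Orig f)" by (auto simp: ear_green_def)
  have "\<not> (\<exists>e. ear_adj ep' (snd P2) (Virt n False) e \<and> e \<noteq> Virt n False \<and>
      (ear_adj ep' (snd H))\<^sup>*\<^sup>* e (Orig f))"
    using assms(1) unfolding nbr_def ear_green_def by blast
  then have "Virt m b \<noteq> Virt n False" "(ear_adj ep' (snd H))\<^sup>*\<^sup>* (Virt m b) (Orig f)"
    using B.ear_class_piece_old[OF f[unfolded snd_pieces] 3(1)[unfolded snd_pieces]] by auto
  then show ?thesis using 3(1) green_label_if_green_H[of m b] by (auto simp: ear_green_def)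
qed

abbreviation "ear_ls \<equiv> ear_labels ep' P1 (Virt n True) \<union> ear_labels ep' P2 (Virt n False)"

lemma ear_ls_iff:
  "m \<in> ear_ls \<longleftrightarrow> (\<exists>b. (ear_adj ep' (snd P1))\<^sup>*\<^sup>* (Virt n True) (Virt m b)) \<or>
     (\<exists>b. (ear_adj ep' (snd P2))\<^sup>*\<^sup>* (Virt n False) (Virt m b))"
proof -
  have "wf_graph ep' (fst P1) (snd P1)" "wf_graph ep' (fst P2) (snd P2)"
    using split_state_st' in_st'(2,3) unfolding split_state_def wf_state_def snd_st' by blast+
  then show ?thesis by (subst ear_labels_eq ear_labels_eq, simp_all)+
qed

lemma green_label_outside_ears:
  assumes "green_label st' m" "m \<notin> ear_ls"
  shows "green_label st m"
  using assms(1)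
proof (cases rule: green_label_cases)
  case (2 b)
  then obtain f where f: "(ear_adj ep' (snd P1))\<^sup>*\<^sup>* (Virt m b) (Orig f)" by (auto simp: ear_green_def)
  have no: "\<not> (ear_adj ep' (snd P1))\<^sup>*\<^sup>* (Virt n True) (Virt m b)" using assms(2) ear_ls_iff by blast
  have "Virt m b \<noteq> Virt n True"
  proof
    assume "Virt m b = Virt n True"
    then show False using no by simp
  qed
  then have "Virt m b \<in> snd H" using 2(1) A.FE by auto
  moreover have "(ear_adj ep' (snd H))\<^sup>*\<^sup>* (Virt m b) (Orig f)"
    using A.ear_class_piece_avoiding f no 2(1) unfolding snd_pieces by blast
  ultimately show ?thesis using green_label_if_green_H unfolding ear_green_def by blast
next
  case (3 b)
  then obtain f where f: "(ear_adj ep' (snd P2))\<^sup>*\<^sup>* (Virt m b) (Orig f)" by (auto simp: ear_green_def)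
  have no: "\<not> (ear_adj ep' (snd P2))\<^sup>*\<^sup>* (Virt n False) (Virt m b)" using assms(2) ear_ls_iff by blast
  have "Virt m b \<noteq> Virt n False"
  proof
    assume "Virt m b = Virt n False"
    then show False using no by simp
  qed
  then have "Virt m b \<in> snd H" using 3(1) by auto
  moreover have "(ear_adj ep' (snd H))\<^sup>*\<^sup>* (Virt m b) (Orig f)"
    using B.ear_class_piece_avoiding f no 3(1) unfolding snd_pieces by blast
  ultimately show ?thesis using green_label_if_green_H unfolding ear_green_def by blast
qed

end

locale twin_free_step = split_step +
  assumes twin_free: "twin_free st'"
begin

text \<open>A split at a vertex of degree 2 would leave that vertex with degree 2 in both pieces.\<close>

lemma degree_pair_not_2:
  assumes "a \<in> {u, v}"
  shows "degree ep' (snd H) a \<noteq> 2"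
proof
  assume "degree ep' (snd H) a = 2"
  then have "degree ep' E' a = 1" "degree ep' (snd H - E') a = 1"
    using A.degree_split[of a] A.degree_side_pos[OF assms] B.degree_side_pos[OF assms] by linarith+
  then have "degree ep' (snd P1) a \<le> 2" "degree ep' (snd P2) a \<le> 2"
    using assms A.degree_piece[of a] B.degree_piece[of a] by simp_all
  moreover have "a \<in> ep' (Virt n True)" "a \<in> ep' (Virt n False)" using assms ep'_new by simp_all
  moreover have "Virt n True \<in> snd P1" "Virt n False \<in> snd P2" by simp_all
  ultimately have "low_edge st' (Virt n True)" "low_edge st' (Virt n False)"
    unfolding low_edge_def snd_st' using in_st'(2,3) by blast+
  then show False using twin_free by (auto simp: twin_free_def)
qed

lemma green_label_mono: "green_label st m \<Longrightarrow> green_label st' m"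
  using green_label_mono_if degree_pair_not_2 by blast

lemma ear_trivial:
  assumes "\<not> low_edge st' x" "K \<in> fst st'" "(ear_adj ep' (snd K))\<^sup>*\<^sup>* x y"
  shows "y = x"
  using assms(3) by (cases rule: converse_rtranclpE) (use low_edge_if_ear_adj(1)[OF assms(2)] assms(1) in auto)

text \<open>The ear of \<open>e\<close> keeps its original edge within its piece and is joined there
  to the new edge, so that whole ear becomes green. The other new copy is not low, hence alone on
  its ear.\<close>

lemma green_label_on_ears:
  assumes e: "nbr e" "green_H e" and m: "m \<in> ear_ls"
  shows "green_label st' m"
proof -
  obtain f where f: "(ear_adj ep' (snd H))\<^sup>*\<^sup>* e (Orig f)" using e(2) by (auto simp: ear_green_def)
  consider "ear_adj ep' (snd P1) (Virt n True) e" "e \<noteq> Virt n True"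
    | "ear_adj ep' (snd P2) (Virt n False) e" "e \<noteq> Virt n False" using e(1) nbr_def by blast
  then show ?thesis
  proof cases
    case 1
    then have "e \<in> E'" by (auto simp: ear_adj_def)
    then have "(ear_adj ep' (snd P1))\<^sup>*\<^sup>* e (Orig f)"
      using A.ear_class_old_piece[OF f _ degree_pair_not_2] by simp
    then have g: "ear_green ep' (snd P1) (Virt n True)"
      using 1(1) by (meson ear_green_def converse_rtranclp_into_rtranclp)
    have "low_edge st' (Virt n True)" using low_edge_if_ear_adj(1)[OF in_st'(2) 1(1)] .
    then have nl: "\<not> low_edge st' (Virt n False)" using twin_free by (auto simp: twin_free_def)
    from m consider b where "(ear_adj ep' (snd P1))\<^sup>*\<^sup>* (Virt n True) (Virt m b)"
      | b where "(ear_adj ep' (snd P2))\<^sup>*\<^sup>* (Virt n False) (Virt m b)" unfolding ear_ls_iff by blast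
    then obtain b where b: "(ear_adj ep' (snd P1))\<^sup>*\<^sup>* (Virt n True) (Virt m b)"
    proof cases
      case 2
      \<comment> \<open>The trivial ear contributes only the new label, which occurs on the green
        ear as well.\<close>
      then have "m = n" using ear_trivial[OF nl in_st'(3)] by blast
      then show thesis using that[of True] by simp
    qed (use that in blast)
    have "Virt m b \<in> snd P1" using ear_class_subset[OF b] by simp
    moreover have "ear_green ep' (snd P1) (Virt m b)"
      using ear_green_class[OF ear_class_sym[OF b] g] .
    ultimately show ?thesis using in_st'(2) unfolding green_label_def snd_st' by blast
  next
    case 2
    then have "e \<in> snd H - E'" by (auto simp: ear_adj_def)
    then have "(ear_adj ep' (snd P2))\<^sup>*\<^sup>* e (Orig f)"
      using B.ear_class_old_piece[OF f _ degree_pair_not_2] by simp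
    then have g: "ear_green ep' (snd P2) (Virt n False)"
      using 2(1) by (meson ear_green_def converse_rtranclp_into_rtranclp)
    have "low_edge st' (Virt n False)" using low_edge_if_ear_adj(1)[OF in_st'(3) 2(1)] .
    then have nl: "\<not> low_edge st' (Virt n True)" using twin_free by (auto simp: twin_free_def)
    from m consider b where "(ear_adj ep' (snd P2))\<^sup>*\<^sup>* (Virt n False) (Virt m b)"
      | b where "(ear_adj ep' (snd P1))\<^sup>*\<^sup>* (Virt n True) (Virt m b)" unfolding ear_ls_iff by blast
    then obtain b where b: "(ear_adj ep' (snd P2))\<^sup>*\<^sup>* (Virt n False) (Virt m b)"
    proof cases
      case 2
      then have "m = n" using ear_trivial[OF nl in_st'(2)] by blast
      then show thesis using that[of False] by simp
    qed (use that in blast)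
    have "Virt m b \<in> snd P2" using ear_class_subset[OF b] by simp
    moreover have "ear_green ep' (snd P2) (Virt m b)"
      using ear_green_class[OF ear_class_sym[OF b] g] .
    ultimately show ?thesis using in_st'(3) unfolding green_label_def snd_st' by blast
  qed
qed

text \<open>A label might be green on account of the other copy of \<open>e\<close>. That copy would
  then have an end of degree 2, which persists to \<open>st'\<close>, where \<open>e\<close> has one
  too; this contradicts \<open>twin_free\<close>.\<close>

lemma nbr_colour:
  assumes col: "ear_coloured st col" and e: "nbr e"
  shows "green_or_orig col e \<longleftrightarrow> green_H e" "\<not> green_H e \<Longrightarrow> is_red col e"
proof -
  have "(green_or_orig col e \<longleftrightarrow> green_H e) \<and> (\<not> green_H e \<longrightarrow> is_red col e)"
  proof (cases e)
    case (Orig f)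
    then have "green_H e" unfolding ear_green_def by blast
    then show ?thesis using Orig by (simp add: green_or_orig_def)
  next
    case (Virt m b)
    have eH: "Virt m b \<in> snd H" using nbr_old[OF e] Virt by simp
    then have "m \<in> labels (fst st)" using HS by (auto simp: labels_def)
    then have cm: "col m = Some (if green_label st m then Green else Red)"
      using col by (simp add: ear_coloured_def)
    have "green_H e" if "green_label st m"
    proof -
      obtain K b' where K: "K \<in> fst st" "Virt m b' \<in> snd K" "ear_green (snd st) (snd K) (Virt m b')"
        using \<open>green_label st m\<close> unfolding green_label_def by blast
      have "b' = b"
      proof (rule ccontr)
        assume "b' \<noteq> b"
        have "low_edge st (Virt m b')"
          using K(1,2) ear_green_virt_low[OF K(3)] unfolding low_edge_def by (metis order_refl)
        then have "low_edge st' (Virt m b')" by (rule low_edge_step)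
        moreover have "low_edge st' (Virt m b)" using nbr_low[OF e] Virt by simp
        ultimately show False using twin_free \<open>b' \<noteq> b\<close> unfolding twin_free_def
          by (metis (full_types))
      qed
      then have "K = H" using K eH HS state unfolding split_state_def wf_state_def by blast
      then show ?thesis using K \<open>b' = b\<close> Virt ear_green_old[OF HS] by simp
    qed
    then have "green_label st m \<longleftrightarrow> green_H e" using green_label_if_green_H eH Virt by blast
    then show ?thesis using cm Virt by (simp add: green_or_orig_def is_red_def)
  qed
  then show "green_or_orig col e \<longleftrightarrow> green_H e" "\<not> green_H e \<Longrightarrow> is_red col e" by blast+
qed

text \<open>Non-supporting splits and splits at red edges only have the same effect, and the last
  branch of \<open>recolour\<close> cannot be reached because a neighbour that is not green is
  red.\<close>

lemma recolour_eq:
  assumes col: "ear_coloured st col"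
  shows "recolour st H u v E' n col =
    (if \<exists>e. nbr e \<and> green_H e then (\<lambda>m. if m \<in> ear_ls then Some Green else col m)
     else col(n := Some Red))"
proof -
  have ex: "(\<exists>c e a. is_25split (snd st) (fst H) (snd H) c e a u v E') \<longleftrightarrow> (\<exists>e. nbr e)"
    using is_25split_iff_nbr by blast
  have gr: "(\<exists>c e a. is_25split (snd st) (fst H) (snd H) c e a u v E' \<and> green_or_orig col e)
      \<longleftrightarrow> (\<exists>e. nbr e \<and> green_H e)"
    using is_25split_iff_nbr nbr_colour(1)[OF col] by blast
  have rd: "\<forall>c e a. is_25split (snd st) (fst H) (snd H) c e a u v E' \<longrightarrow> is_red col e"
    if "\<not> (\<exists>e. nbr e \<and> green_H e)"
    using that is_25split_iff_nbr nbr_colour(2)[OF col] by blast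
  show ?thesis unfolding recolour_def Let_def ex gr using rd by auto
qed

lemma ear_coloured_step:
  assumes col: "ear_coloured st col"
  shows "ear_coloured st' (recolour st H u v E' n col)"
  unfolding ear_coloured_def
proof
  fix m assume m: "m \<in> labels (fst st')"
  have n_new: "n \<notin> labels (fst st)" using ok by (simp add: split_ok_def)
  show "recolour st H u v E' n col m = Some (if green_label st' m then Green else Red)"
  proof (cases "\<exists>e. nbr e \<and> green_H e")
    case True
    then have rc: "recolour st H u v E' n col m = (if m \<in> ear_ls then Some Green else col m)"
      using recolour_eq[OF col] by simp
    show ?thesis
    proof (cases "m \<in> ear_ls")
      case True
      then show ?thesis using rc green_label_on_ears \<open>\<exists>e. nbr e \<and> green_H e\<close> by auto
    next
      case False
      \<comment> \<open>Hence a label off these ears is older than the split, so the hypothesis on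
        \<open>col\<close> applies to it.\<close>
      have "n \<in> ear_ls" unfolding ear_ls_iff by blast
      then have "m \<in> labels (fst st)" using False m labels_st' by auto
      moreover have "green_label st' m \<longleftrightarrow> green_label st m"
        using green_label_mono green_label_outside_ears[OF _ False] by blast
      ultimately show ?thesis using rc False col by (simp add: ear_coloured_def)
    qed
  next
    case False
    then have rc: "recolour st H u v E' n col = col(n := Some Red)"
      unfolding recolour_eq[OF col] by (simp only: if_False)
    have gl: "green_label st' m \<longleftrightarrow> green_label st m" for m
      using green_label_mono green_label_stable False by blast
    show ?thesis
    proof (cases "m = n")
      case True
      then show ?thesis using rc gl n_new green_label_in_labels[of st n] by auto
    next
      case False
      then have "m \<in> labels (fst st)" using m labels_st' by auto
      then show ?thesis using rc gl False col by (simp add: ear_coloured_def)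
    qed
  qed
qed

end

theorem run_ear_coloured:
  assumes "run st col ss F c" "split_state st" "twin_free F" "ear_coloured st col"
  shows "ear_coloured F c"
  using assms
proof (induction rule: run.induct)
  case (run_Cons st H u v E' n col ss st'' col'')
  interpret split_step st H u v E' n
    using run_Cons.hyps(1) run_Cons.prems(1) by (rule split_step.intro[rotated])
  interpret twin_free_step st H u v E' n
    using run_twin_free[OF run_Cons.hyps(2) split_state_st' run_Cons.prems(2)] by unfold_locales
  show ?case
    using run_Cons.IH[OF split_state_st' run_Cons.prems(2)] ear_coloured_step run_Cons.prems(3) by blast
qed

section \<open>Triconnected components\<close>

text \<open>Used with \<open>Orig\<close>, to pass from the given graph to the initial state, and
  with \<open>relabel\<close>, to compare isomorphic states.\<close>

locale edge_bijection =
  fixes g :: "'x \<Rightarrow> 'y" and ep1 :: "'x \<Rightarrow> 'v set" and ep2 :: "'y \<Rightarrow> 'v set" and E :: "'x set"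
  assumes inj: "inj_on g E" and ends: "\<And>f. f \<in> E \<Longrightarrow> ep2 (g f) = ep1 f"
begin

lemma degree_image: "degree ep2 (g ` E) a = degree ep1 E a"
proof -
  have "{f \<in> g ` E. a \<in> ep2 f} = g ` {f \<in> E. a \<in> ep1 f}" using ends by auto
  moreover have "inj_on g {f \<in> E. a \<in> ep1 f}" using inj by (rule inj_on_subset) auto
  ultimately show ?thesis by (simp add: degree_def card_image)
qed

lemma step_image: "step ep2 V (g ` E) = step ep1 V E"
  using ends by (auto simp: step_def fun_eq_iff)

lemma connected_graph_image: "connected_graph ep2 V (g ` E) = connected_graph ep1 V E"
  by (simp add: connected_graph_iff_steps step_image)

lemma biconnected_image: "biconnected ep2 V (g ` E) = biconnected ep1 V E"
  by (simp add: biconnected_iff connected_graph_image)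

lemma wf_graph_image: "wf_graph ep2 V (g ` E) = wf_graph ep1 V E"
  using ends inj by (auto simp: wf_graph_def finite_image_iff)

lemma ear_adj_image: "x \<in> E \<Longrightarrow> y \<in> E \<Longrightarrow> ear_adj ep2 (g ` E) (g x) (g y) \<longleftrightarrow> ear_adj ep1 E x y"
  using ends by (simp add: ear_adj_def degree_image)

lemma ear_class_image:
  assumes "x \<in> E"
  shows "(ear_adj ep2 (g ` E))\<^sup>*\<^sup>* (g x) z \<longleftrightarrow> (\<exists>y\<in>E. z = g y \<and> (ear_adj ep1 E)\<^sup>*\<^sup>* x y)"
proof
  assume "(ear_adj ep2 (g ` E))\<^sup>*\<^sup>* (g x) z"
  then show "\<exists>y\<in>E. z = g y \<and> (ear_adj ep1 E)\<^sup>*\<^sup>* x y"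
  proof (induction rule: rtranclp_induct)
    case base
    then show ?case using assms by blast
  next
    case (step z w)
    then obtain y where y: "y \<in> E" "z = g y" "(ear_adj ep1 E)\<^sup>*\<^sup>* x y" by blast
    obtain y' where y': "y' \<in> E" "w = g y'" using step.hyps by (auto simp: ear_adj_def)
    then have "ear_adj ep1 E y y'" using step.hyps y ear_adj_image by simp
    then have "(ear_adj ep1 E)\<^sup>*\<^sup>* x y'" using y(3) by simp
    then show ?case using y' by blast
  qed
next
  assume "\<exists>y\<in>E. z = g y \<and> (ear_adj ep1 E)\<^sup>*\<^sup>* x y"
  then obtain y where z: "z = g y" and xy: "(ear_adj ep1 E)\<^sup>*\<^sup>* x y" by blast
  from xy have "(ear_adj ep2 (g ` E))\<^sup>*\<^sup>* (g x) (g y)"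
  proof (induction rule: rtranclp_induct)
    case (step y y')
    then have "ear_adj ep2 (g ` E) (g y) (g y')"
      using ear_adj_image[of y y'] by (auto simp: ear_adj_def)
    then show ?case using step.IH by simp
  qed simp
  then show "(ear_adj ep2 (g ` E))\<^sup>*\<^sup>* (g x) z" using z by simp
qed

end

text \<open>Splits preserve \<open>weight\<close>, and a merge preserves it only if the two merged graphs have
  no vertices in common besides the ends of the merged edges.\<close>

lemma merge_rel_step:
  assumes wfs: "wf_state S" and m: "merge_rel S S'"
  shows "wf_state S'" "weight S' \<le> weight S"
    and "weight S' = weight S \<Longrightarrow> \<forall>H\<in>fst S. cycle_or_min_degree_3 (snd S) (fst H) (snd H) \<Longrightarrow>
      \<forall>H\<in>fst S'. cycle_or_min_degree_3 (snd S') (fst H) (snd H)"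
proof -
  obtain V1 E1 V2 E2 n where H: "(V1, E1) \<in> fst S" "(V2, E2) \<in> fst S" "(V1, E1) \<noteq> (V2, E2)"
    and t: "Virt n True \<in> E1" "Virt n False \<in> E2"
    and kind: "(polygon (snd S) V1 E1 \<and> polygon (snd S) V2 E2) \<or>
       (multiedge (snd S) V1 E1 \<and> multiedge (snd S) V2 E2)"
    and S': "S' = ((fst S - {(V1, E1), (V2, E2)}) \<union>
               {(V1 \<union> V2, (E1 \<union> E2) - {Virt n True, Virt n False})}, snd S)"
    using m unfolding merge_rel_def by (metis prod.collapse)
  define ep where "ep = snd S"
  define U where "U = ep (Virt n True)"
  define M where "M = (E1 \<union> E2) - {Virt n True, Virt n False}"
  define R where "R = fst S - {(V1, E1), (V2, E2)}"
  have finS: "finite (fst S)" and disj: "\<And>K L. K \<in> fst S \<Longrightarrow> L \<in> fst S \<Longrightarrow> K \<noteq> L \<Longrightarrow> snd K \<inter> snd L = {}"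
    and wfg: "\<And>K. K \<in> fst S \<Longrightarrow> wf_graph ep (fst K) (snd K)"
    and twin: "\<And>m. ep (Virt m True) = ep (Virt m False)"
    using wfs unfolding wf_state_def ep_def by blast+
  have wf12: "wf_graph ep V1 E1" "wf_graph ep V2 E2" using wfg[OF H(1)] wfg[OF H(2)] by simp_all
  have fin: "finite V1" "finite V2" "finite E1" "finite E2" using wf12 by (auto simp: wf_graph_def)
  have E12: "E1 \<inter> E2 = {}" using disj[OF H] by simp
  have tt: "Virt n False \<notin> E1" "Virt n True \<notin> E2" using t E12 by auto
  have UT: "ep (Virt n True) = U" and UF: "ep (Virt n False) = U" using twin[of n] U_def by simp_all
  have U: "card U = 2" "U \<subseteq> V1" "U \<subseteq> V2"
    using wf12 t UT UF by (metis wf_graph_def)+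
  have fst': "fst S' = R \<union> {(V1 \<union> V2, M)}" and snd': "snd S' = ep"
    unfolding S' R_def M_def ep_def by simp_all
  have wfM: "wf_graph ep (V1 \<union> V2) M" using wf12 unfolding M_def by (auto simp: wf_graph_def)
  \<comment> \<open>Makes \<open>M\<close> nonempty. As \<open>M\<close> is disjoint from all other
    edge sets, the merged graph is then really new and adds its own term to the sum.\<close>
  have deg1: "\<exists>f\<in>E1. f \<noteq> Virt n True"
  proof -
    have "E1 \<noteq> {Virt n True}"
    proof
      assume e: "E1 = {Virt n True}"
      have "U \<noteq> {}" using U by auto
      then obtain a where a: "a \<in> V1" using U by blast
      have "degree (snd S) E1 a \<le> card E1"
        unfolding degree_def using fin by (intro card_mono) auto
      moreover have "card E1 = 1" using e by simp
      moreover have "degree (snd S) E1 a = 2 \<or> 2 \<le> card E1"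
        using kind a by (auto simp: polygon_def multiedge_def)
      ultimately show False by linarith
    qed
    then show ?thesis using t by auto
  qed
  have dM: "snd K \<inter> M = {}" if "K \<in> R" for K
    using that disj[of K "(V1, E1)"] disj[of K "(V2, E2)"] H unfolding R_def M_def by auto
  have MR: "(V1 \<union> V2, M) \<notin> R"
  proof
    assume "(V1 \<union> V2, M) \<in> R"
    then have "M = {}" using dM by fastforce
    then show False using deg1 tt unfolding M_def by auto
  qed
  show "wf_state S'"
  proof -
    have "finite (fst S')" unfolding fst' R_def using finS by simp
    moreover have "wf_graph ep (fst K) (snd K)" if "K \<in> fst S'" for K
      using that wfM wfg unfolding fst' R_def by auto
    moreover have "snd K \<inter> snd L = {}" if KL: "K \<in> fst S'" "L \<in> fst S'" "K \<noteq> L" for K L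
    proof -
      have "K \<in> R \<or> K = (V1 \<union> V2, M)" "L \<in> R \<or> L = (V1 \<union> V2, M)" using KL unfolding fst' by auto
      moreover have "snd K \<inter> snd L = {}" if "K \<in> R" "L \<in> R"
        using that disj KL(3) unfolding R_def by blast
      ultimately show ?thesis using dM[of K] dM[of L] KL(3) by auto
    qed
    ultimately show ?thesis unfolding wf_state_def snd' using twin by blast
  qed
  let ?w = "\<lambda>K :: 'a set \<times> 'b edg set. int (card (fst K)) - 2"
  have finR: "finite R" unfolding R_def using finS by simp
  have wS': "weight S' = sum ?w R + (int (card (V1 \<union> V2)) - 2)"
    unfolding weight_def fst' using MR finR by simp
  have S: "fst S = insert (V1, E1) (insert (V2, E2) R)" unfolding R_def using H by auto
  have "(V1, E1) \<notin> insert (V2, E2) R" "(V2, E2) \<notin> R" unfolding R_def using H(3) by auto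
  then have wS: "weight S = sum ?w R + (int (card V1) - 2) + (int (card V2) - 2)"
    unfolding weight_def S using finR by simp
  have cUn: "card V1 + card V2 = card (V1 \<union> V2) + card (V1 \<inter> V2)" using fin by (intro card_Un_Int)
  have cI: "2 \<le> card (V1 \<inter> V2)" using U fin card_mono[of "V1 \<inter> V2" U] by simp
  show "weight S' \<le> weight S" unfolding wS wS' using cUn cI by linarith
  assume eq: "weight S' = weight S"
    and cyc: "\<forall>H\<in>fst S. cycle_or_min_degree_3 (snd S) (fst H) (snd H)"
  \<comment> \<open>The loss of weight is the overlap minus 2, so equality pins the overlap down to
    the ends of the merged edges.\<close>
  have "card (V1 \<inter> V2) = 2" using eq cUn unfolding wS wS' by linarith
  then have I: "V1 \<inter> V2 = U" using U fin card_subset_eq[of "V1 \<inter> V2" U] by simp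
  have c12: "cycle_or_min_degree_3 ep V1 E1" "cycle_or_min_degree_3 ep V2 E2"
    using cyc H(1,2) unfolding ep_def by fastforce+
  have degM: "degree ep M x = (degree ep E1 x - (if x \<in> U then 1 else 0)) +
      (degree ep E2 x - (if x \<in> U then 1 else 0))" for x
  proof -
    let ?A = "{f \<in> E1. x \<in> ep f}" and ?B = "{f \<in> E2. x \<in> ep f}"
    have "{f \<in> M. x \<in> ep f} = (?A - {Virt n True}) \<union> (?B - {Virt n False})"
      unfolding M_def using tt by auto
    moreover have "card ((?A - {Virt n True}) \<union> (?B - {Virt n False})) =
        card (?A - {Virt n True}) + card (?B - {Virt n False})"
      using fin E12 by (intro card_Un_disjoint) auto
    moreover have "card (?A - {Virt n True}) = card ?A - (if x \<in> U then 1 else 0)"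
      using t UT fin by (auto simp: card_Diff_singleton_if)
    moreover have "card (?B - {Virt n False}) = card ?B - (if x \<in> U then 1 else 0)"
      using t UF fin by (auto simp: card_Diff_singleton_if)
    ultimately show ?thesis unfolding degree_def by simp
  qed
  have out: "degree ep E2 x = 0" if "x \<notin> V2" for x
  proof -
    have "{f \<in> E2. x \<in> ep f} = {}" using that wf12 by (auto simp: wf_graph_def)
    then show ?thesis unfolding degree_def by (metis card.empty)
  qed
  have out1: "degree ep E1 x = 0" if "x \<notin> V1" for x
  proof -
    have "{f \<in> E1. x \<in> ep f} = {}" using that wf12 by (auto simp: wf_graph_def)
    then show ?thesis unfolding degree_def by (metis card.empty)
  qed
  have "cycle_or_min_degree_3 ep (V1 \<union> V2) M"
  proof (cases "polygon ep V1 E1 \<and> polygon ep V2 E2")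
    case True
    then have d: "\<And>x. x \<in> V1 \<Longrightarrow> degree ep E1 x = 2" "\<And>x. x \<in> V2 \<Longrightarrow> degree ep E2 x = 2"
      and "3 \<le> card V1" by (auto simp: polygon_def)
    moreover have "card V1 \<le> card (V1 \<union> V2)" using fin by (intro card_mono) auto
    moreover have "degree ep M x = 2" if x: "x \<in> V1 \<union> V2" for x
    proof (cases "x \<in> U")
      case True
      then have "x \<in> V1" "x \<in> V2" using U by auto
      then show ?thesis unfolding degM using d True by simp
    next
      case False
      then consider "x \<in> V1" "x \<notin> V2" | "x \<notin> V1" "x \<in> V2" using x I by blast
      then show ?thesis by cases (simp_all add: degM d out out1 False)
    qed
    ultimately show ?thesis unfolding cycle_or_min_degree_3_def by (meson order_trans)
  next
    case False
    \<comment> \<open>Both graphs live on \<open>U\<close>. With two vertices the cycle alternative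
      fails, so all degrees are at least 3, and removing one copy from each side leaves at least 2 +
      2 edges.\<close>
    then have cV: "card V1 = 2" "card V2 = 2" using kind unfolding ep_def by (auto simp: multiedge_def)
    then have V: "V1 = U" "V2 = U"
      using U fin card_subset_eq[of V1 U] card_subset_eq[of V2 U] by simp_all
    have "3 \<le> degree ep E1 x" "3 \<le> degree ep E2 x" if "x \<in> U" for x
      using c12 that V cV unfolding cycle_or_min_degree_3_def by auto
    then have "3 \<le> degree ep M x" if "x \<in> U" for x
      unfolding degM using that by fastforce
    then show ?thesis unfolding cycle_or_min_degree_3_def V by simp
  qed
  moreover have "cycle_or_min_degree_3 ep (fst K) (snd K)" if "K \<in> R" for K
    using that cyc unfolding R_def ep_def by blast
  ultimately show "\<forall>H\<in>fst S'. cycle_or_min_degree_3 (snd S') (fst H) (snd H)"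
    unfolding fst' snd' by auto
qed

text \<open>Weights never increase, so equality between the two ends forces equality at every
  merge.\<close>

lemma merge_rel_rtrancl:
  assumes "merge_rel\<^sup>*\<^sup>* S T" "wf_state S"
    "\<forall>H\<in>fst S. cycle_or_min_degree_3 (snd S) (fst H) (snd H)"
  shows "wf_state T \<and> weight T \<le> weight S \<and> (weight T = weight S \<longrightarrow>
    (\<forall>H\<in>fst T. cycle_or_min_degree_3 (snd T) (fst H) (snd H)))"
  using assms(1)
proof (induction rule: rtranclp_induct)
  case base
  then show ?case using assms by simp
next
  case (step T T')
  then have T: "wf_state T" "weight T \<le> weight S" by blast+
  note ms = merge_rel_step[OF T(1) step.hyps(2)]
  have "weight T' = weight S \<Longrightarrow> weight T' = weight T \<and> weight T = weight S"
    using ms(2) T(2) by linarith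
  then show ?case using ms T step.IH by (metis order_trans)
qed

lemma finite_labels:
  assumes "wf_state S"
  shows "finite (labels (fst S))"
proof -
  have "labels (fst S) \<subseteq> (\<lambda>x. case x of Virt n b \<Rightarrow> n | Orig _ \<Rightarrow> 0) ` \<Union> (snd ` fst S)"
    by (force simp: labels_def)
  moreover have "finite (\<Union> (snd ` fst S))"
    using assms by (auto simp: wf_state_def wf_graph_def)
  ultimately show ?thesis by (meson finite_imageI finite_subset)
qed

lemma unsplittable_state:
  assumes S: "split_state S" and ns: "\<not> (\<exists>st'. split_rel S st')" and H: "H \<in> fst S"
  shows "cycle_or_min_degree_3 (snd S) (fst H) (snd H)"
proof -
  have w: "wf_state S" "wf_graph (snd S) (fst H) (snd H)" "biconnected (snd S) (fst H) (snd H)"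
    "3 \<le> card (snd H)"
    using S H by (auto simp: split_state_def wf_state_def)
  \<comment> \<open>A state could also be stuck for want of a fresh label; finiteness excludes this,
    so the lack of a separation is the true reason.\<close>
  obtain n where "n \<notin> labels (fst S)"
    using finite_labels[OF w(1)] ex_new_if_finite infinite_UNIV_nat by blast
  then have "\<not> sep_union (snd S) (fst H) (snd H) u v F" for u v F
    using ns H w(3) unfolding split_rel_def split_ok_def by blast
  then show ?thesis using w by (intro unsplittable_cycle_or_min_degree_3)
qed

lemma split_state_init:
  assumes "wf_graph epG VG EG" "biconnected epG VG EG" "3 \<le> card EG"
  shows "split_state (init_state VG EG epG)"
proof -
  let ?ep = "\<lambda>x. case x of Orig f \<Rightarrow> epG f | Virt _ _ \<Rightarrow> {}"
  interpret edge_bijection Orig epG ?ep EG by unfold_locales (auto simp: inj_on_def)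
  have "card (Orig ` EG) = card EG" using inj by (rule card_image)
  then show ?thesis
    using assms wf_graph_image biconnected_image
    by (auto simp: split_state_def wf_state_def init_state_def)
qed

section \<open>Transport along relabellings of states\<close>

locale state_iso =
  fixes st1 st2 :: "('v, 'e) state" and \<sigma> :: "nat \<Rightarrow> nat" and \<beta> :: "nat \<Rightarrow> bool \<Rightarrow> bool"
  assumes iso: "iso_state st1 st2 \<sigma> \<beta>"
begin

abbreviation "g \<equiv> relabel \<sigma> \<beta>"

lemma inj_all: "inj_on g (\<Union> (snd ` fst st1))"
proof (rule inj_onI)
  fix x y assume x: "x \<in> \<Union> (snd ` fst st1)" and y: "y \<in> \<Union> (snd ` fst st1)" and eq: "g x = g y"
  have i: "inj_on \<sigma> (labels (fst st1))" "\<And>n. inj (\<beta> n)" using iso by (auto simp: iso_state_def)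
  show "x = y"
  proof (cases x)
    case (Orig f)
    then show ?thesis using eq by (cases y) auto
  next
    case (Virt n b)
    then obtain m b' where y': "y = Virt m b'" using eq by (cases y) auto
    have "n \<in> labels (fst st1)" "m \<in> labels (fst st1)" using x y Virt y' by (auto simp: labels_def)
    then have "n = m" using eq Virt y' i(1) by (auto dest: inj_onD)
    then show ?thesis using eq Virt y' i(2)[of n] by (auto dest: injD)
  qed
qed

lemma edge_bijection_component: "H \<in> fst st1 \<Longrightarrow> edge_bijection g (snd st1) (snd st2) (snd H)"
proof
  assume H: "H \<in> fst st1"
  show "inj_on g (snd H)" using inj_all by (rule inj_on_subset) (use H in auto)
  show "\<And>f. f \<in> snd H \<Longrightarrow> snd st2 (g f) = snd st1 f" using H iso by (auto simp: iso_state_def)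
qed

lemma image_states: "fst st2 = (\<lambda>H. (fst H, g ` snd H)) ` fst st1"
  using iso by (simp add: iso_state_def)

lemma inj_components: "inj_on (\<lambda>H. (fst H, g ` snd H)) (fst st1)"
proof (rule inj_onI)
  fix H K assume "H \<in> fst st1" "K \<in> fst st1" "(fst H, g ` snd H) = (fst K, g ` snd K)"
  moreover from this have "snd H = snd K" using inj_on_image_eq_iff[OF inj_all, of "snd H" "snd K"] by auto
  ultimately show "H = K" by (simp add: prod_eq_iff)
qed

lemma weight_eq: "weight st2 = weight st1"
  unfolding weight_def image_states using inj_components by (simp add: sum.reindex)

text \<open>Relabelling fixes original edges and sends virtual edges to virtual ones, so by
  \<open>ear_class_image\<close> an ear contains an original edge iff its image does.\<close>

lemma green_label_iff:
  assumes n: "n \<in> labels (fst st1)"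
  shows "green_label st2 (\<sigma> n) \<longleftrightarrow> green_label st1 n"
proof -
  have image: "ear_green (snd st2) (g ` snd H) (g x) \<longleftrightarrow> ear_green (snd st1) (snd H) x"
    if H: "H \<in> fst st1" "x \<in> snd H" for H x
  proof -
    interpret edge_bijection g "snd st1" "snd st2" "snd H" using edge_bijection_component H by blast
    have "(Orig f = g y) \<longleftrightarrow> y = Orig f" for f y by (cases y) auto
    then show ?thesis unfolding ear_green_def ear_class_image[OF H(2)]
      using ear_class_subset[OF _ H(2)] by metis
  qed
  show ?thesis
  proof
    assume "green_label st2 (\<sigma> n)"
    then obtain H b where H: "H \<in> fst st1" "Virt (\<sigma> n) b \<in> g ` snd H"
      "ear_green (snd st2) (g ` snd H) (Virt (\<sigma> n) b)"
      unfolding green_label_def image_states by auto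
    then obtain x where x: "x \<in> snd H" "Virt (\<sigma> n) b = g x" by blast
    then obtain m b' where xm: "x = Virt m b'" "\<sigma> m = \<sigma> n" by (cases x) auto
    then have "m \<in> labels (fst st1)" using x H by (auto simp: labels_def)
    then have "m = n" using n xm iso by (auto simp: iso_state_def dest: inj_onD)
    then show "green_label st1 n"
      using image[OF H(1) x(1)] H x xm unfolding green_label_def by auto
  next
    assume "green_label st1 n"
    then obtain H b where H: "H \<in> fst st1" "Virt n b \<in> snd H" "ear_green (snd st1) (snd H) (Virt n b)"
      unfolding green_label_def by blast
    then have "ear_green (snd st2) (g ` snd H) (Virt (\<sigma> n) (\<beta> n b))"
      using image[OF H(1,2)] by simp
    moreover have "Virt (\<sigma> n) (\<beta> n b) \<in> g ` snd H" using H(2) by force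
    ultimately show "green_label st2 (\<sigma> n)"
      unfolding green_label_def image_states using H(1) by auto
  qed
qed

lemma label_image: "n \<in> labels (fst st1) \<Longrightarrow> \<sigma> n \<in> labels (fst st2)"
  unfolding labels_def image_states by force

end

text \<open>\<open>F\<close> and the unsplittable \<open>SC\<close> both arise from the initial
  state by splits, and \<open>T\<close> is isomorphic to \<open>F\<close>, so all have equal weight.
  The merges from \<open>SC\<close> to \<open>T\<close> are therefore lossless, and a component of
  \<open>T\<close> with a vertex of degree at most 2 is a polygon. Two low copies would lie in two
  polygons that could still be merged.\<close>

lemma produces_tricomps_twin_free:
  assumes init: "split_state (init_state VG EG epG)"
    and F: "split_state F" "weight F = weight (init_state VG EG epG)"
    and prod: "produces_tricomps VG EG epG F"
  shows "twin_free F"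
  unfolding twin_free_def
proof (intro allI notI)
  fix n assume low: "low_edge F (Virt n True) \<and> low_edge F (Virt n False)"
  obtain T \<sigma> \<beta> SC where iso: "iso_state F T \<sigma> \<beta>"
    and SC: "split_rel\<^sup>*\<^sup>* (init_state VG EG epG) SC" "\<not> (\<exists>st'. split_rel SC st')"
    and T: "merge_rel\<^sup>*\<^sup>* SC T" "\<not> (\<exists>st'. merge_rel T st')"
    using prod unfolding produces_tricomps_def is_tricomps_def by blast
  interpret state_iso F T \<sigma> \<beta> using iso by unfold_locales
  have SC': "split_state SC" "weight SC = weight F"
    using split_rel_split_state[OF SC(1) init] F(2) by auto
  have "wf_state SC" using SC'(1) by (simp add: split_state_def)
  then have cyc: "\<And>H. H \<in> fst T \<Longrightarrow> cycle_or_min_degree_3 (snd T) (fst H) (snd H)"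
    using merge_rel_rtrancl[OF T(1)] unsplittable_state[OF SC'(1) SC(2)] weight_eq SC'(2) by auto
  have poly: "polygon (snd T) (fst K) (g ` snd K)"
    if K: "K \<in> fst F" "f \<in> snd K" "a \<in> snd F f" "degree (snd F) (snd K) a \<le> 2" for K f a
  proof -
    interpret edge_bijection g "snd F" "snd T" "snd K" using edge_bijection_component K(1) by blast
    have w: "wf_graph (snd F) (fst K) (snd K)" "biconnected (snd F) (fst K) (snd K)"
      using F(1) K(1) by (auto simp: split_state_def wf_state_def)
    have a: "a \<in> fst K" using w K(2,3) by (auto simp: wf_graph_def)
    have "(fst K, g ` snd K) \<in> fst T" using K(1) image_states by simp
    then have "cycle_or_min_degree_3 (snd T) (fst K) (g ` snd K)" using cyc by force
    moreover have "\<not> 3 \<le> degree (snd T) (g ` snd K) a" using K(4) degree_image[of a] by simp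
    ultimately show ?thesis
      using a w wf_graph_image connected_graph_image
      by (auto simp: polygon_def cycle_or_min_degree_3_def biconnected_iff)
  qed
  obtain K1 where K1: "K1 \<in> fst F" "Virt n True \<in> snd K1" "polygon (snd T) (fst K1) (g ` snd K1)"
    using low poly unfolding low_edge_def by metis
  obtain K2 where K2: "K2 \<in> fst F" "Virt n False \<in> snd K2" "polygon (snd T) (fst K2) (g ` snd K2)"
    using low poly unfolding low_edge_def by metis
  have "K1 \<noteq> K2" using F(1) K1(1,2) K2(1,2) by (auto simp: split_state_def)
  then have ne: "(fst K1, g ` snd K1) \<noteq> (fst K2, g ` snd K2)"
    using inj_components K1(1) K2(1) unfolding inj_on_def by blast
  have inT: "(fst K1, g ` snd K1) \<in> fst T" "(fst K2, g ` snd K2) \<in> fst T"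
    using K1(1) K2(1) image_states by simp_all
  have v: "Virt (\<sigma> n) (\<beta> n True) \<in> g ` snd K1" "Virt (\<sigma> n) (\<beta> n False) \<in> g ` snd K2"
    using K1(2) K2(2) by force+
  have "inj (\<beta> n)" using iso by (simp add: iso_state_def)
  then have "\<beta> n True \<noteq> \<beta> n False" by (auto dest: injD)
  \<comment> \<open>The relabelling may exchange the two copies of a label, while
    \<open>merge_rel\<close> fixes which copy lies in its first graph.\<close>
  then consider "\<beta> n True" "\<not> \<beta> n False" | "\<not> \<beta> n True" "\<beta> n False" by blast
  then show False
  proof cases
    case 1
    then have "\<exists>st'. merge_rel T st'" unfolding merge_rel_def
      using inT ne v K1(3) K2(3) by (metis (full_types) fst_conv snd_conv)
    then show False using T(2) by blast
  next
    case 2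
    then have "\<exists>st'. merge_rel T st'" unfolding merge_rel_def
      using inT ne v K1(3) K2(3) by (metis (full_types) fst_conv snd_conv)
    then show False using T(2) by blast
  qed
qed

text \<open>\<open>split_state\<close> demands three edges. With fewer, no split exists, since two
  sides of at least two edges each require four; then no label occurs at all.\<close>

lemma final_colouring:
  assumes G: "wf_graph epG VG EG" "biconnected epG VG EG"
    and run: "run (init_state VG EG epG) (\<lambda>_. None) s F c"
    and prod: "produces_tricomps VG EG epG F"
  shows "ear_coloured F c"
proof (cases "3 \<le> card EG")
  case True
  have init: "split_state (init_state VG EG epG)" using split_state_init[OF G True] .
  have "labels (fst (init_state VG EG epG)) = {}" by (auto simp: labels_def init_state_def)
  then have "ear_coloured (init_state VG EG epG) (\<lambda>_. None)" by (simp add: ear_coloured_def)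
  moreover have "twin_free F"
    using produces_tricomps_twin_free[OF init _ _ prod] run_split_state[OF run init] by blast
  ultimately show ?thesis using run_ear_coloured[OF run init] by blast
next
  case False
  have "F = init_state VG EG epG"
    using run
  proof (cases rule: run.cases)
    case (run_Cons H u v E' n ss)
    then have H: "H = (VG, Orig ` EG)" and s: "E' \<subseteq> snd H" "2 \<le> card E'" "2 \<le> card (snd H - E')"
      by (auto simp: split_ok_def init_state_def sep_union_def)
    have fin: "finite (snd H)" using G(1) H by (simp add: wf_graph_def)
    have "card (snd H) = card E' + card (snd H - E')"
      using fin s(1) by (metis card_Diff_subset card_mono finite_subset le_add_diff_inverse)
    moreover have "card (snd H) \<le> card EG" using H G(1) by (simp add: card_image_le wf_graph_def)
    ultimately show ?thesis using s False by linarith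
  qed simp
  then have "labels (fst F) = {}" by (auto simp: labels_def init_state_def)
  then show ?thesis by (simp add: ear_coloured_def)
qed

theorem theorem3:
  fixes VG :: "'v set" and EG :: "'e set" and epG :: "'e \<Rightarrow> 'v set"
    and s1 s2 :: "(('v, 'e) gr \<times> 'v \<times> 'v \<times> 'e edg set \<times> nat) list"
    and F1 F2 :: "('v, 'e) state" and c1 c2 :: colouring
    and \<sigma> :: "nat \<Rightarrow> nat" and \<beta> :: "nat \<Rightarrow> bool \<Rightarrow> bool"
  assumes "wf_graph epG VG EG"
    and "biconnected epG VG EG"
    and "run (init_state VG EG epG) (\<lambda>_. None) s1 F1 c1"
    and "produces_tricomps VG EG epG F1"
    and "run (init_state VG EG epG) (\<lambda>_. None) s2 F2 c2"
    and "produces_tricomps VG EG epG F2"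
    and "iso_state F1 F2 \<sigma> \<beta>"
  shows "\<forall>n\<in>labels (fst F1). c2 (\<sigma> n) = c1 n"
proof
  fix n assume n: "n \<in> labels (fst F1)"
  interpret state_iso F1 F2 \<sigma> \<beta> using assms(7) by unfold_locales
  have "ear_coloured F1 c1" using final_colouring assms(1-4) by blast
  moreover have "ear_coloured F2 c2" using final_colouring assms(1,2,5,6) by blast
  ultimately show "c2 (\<sigma> n) = c1 n"
    using n label_image[OF n] green_label_iff[OF n] by (simp add: ear_coloured_def)
qed

end
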